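(* Let $n\geq 16$, $r\geq0$ and $\mathbf{X}=(X_1,\dots,X_n)\sim\mu^n$. Then $$\mathbb{V}[G(\mathbf{X},r)]\leq\frac{2(1+\mathbb{E}[h(\mathbf{X},r)])}{n},\qquad \mathbb{V}[\hat M(\mathbf{X},r)]\leq\frac{2\mathbb{E}[h(\mathbf{X},r)]+4(e-2)(\ln n+1)}{n-1}.$$ Furthermore, for any $t>0$, $$\mathbb{P}\left\{|G(\mathbf{X},r)-\mathbb{E}[G(\mathbf{X},r)]|>12\sqrt{\frac{(1+\mathbb{E}[h(\mathbf{X},r)])t}{n}}+\frac{23t}{\sqrt n}\right\}\leq 15e^{-t},$$ $$\mathbb{P}\left\{|\hat M(\mathbf{X},r)-\mathbb{E}[\hat M(\mathbf{X},r)]|>12\sqrt{\frac{\mathbb{E}[h(\mathbf{X},r)]\,t}{n}}+\frac{37t}{\sqrt{n-1}}\right\}\leq 2ne^{-t}.$$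
   Context: $\mathcal{X}$ is a Hausdorff space with Borel probability measure $\mu$ and a continuous function $d:\mathcal{X}\times\mathcal{X}\to[0,\infty)$ (not necessarily a metric) with $d(x,x)=0$ and $d(x,y)=d(y,x)$. $[n]=\{1,\dots,n\}$, $B(x,r)=\{y: d(x,y)\leq r\}$. $X_1,\dots,X_n$ are independent with law $\mu$. The conditional missing mass is $\hat M(\mathbf{X},r)=\mu\big(\bigcap_{k\in[n]}B(X_k,r)^c\big)$ and the Good-Turing estimator is $G(\mathbf{X},r)=\frac1n\sum_{k=1}^n\mathbf{1}\{X_k\in\bigcap_{i\in[n]:i\neq k}B(X_i,r)^c\}$. A finite sequence $(x_1,\dots,x_k)\in\mathcal{X}^k$ has the $r$-local-separation property if (locality) there exists $y\in\mathcal{X}$ with $d(x_i,y)\leq r$ for all $i\in[k]$, and (separation) $d(x_i,x_j)>r$ for all $1\leq i<j\leq k$. For $\mathbf{x}\in\mathcal{X}^n$, $h(\mathbf{x},r)$ is the largest length of a subsequence of $\mathbf{x}=(x_1,\dots,x_n)$ having the $r$-local-separation property. $\mathbb{V}$ denotes variance.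
   Formalization: The formal theorem additionally assumes that d is measurable for the completion of μ×μ and that h(·,r) is measurable for the completion of μ^n; in a general Hausdorff space these can fail, and then E[h(X,r)] or the law of G and the missing mass is undefined. *)

theory Defs
  imports "HOL-Probability.Probability" "HOL-Library.Sublist"
begin

text \<open>
  The dissimilarity \<open>d\<close> is an arbitrary two-place function, so its closed balls are not
  \<^const>\<open>cball\<close>. Samples \<open>(x\<^sub>1, \<dots>, x\<^sub>n)\<close> are functions on \<open>{1..n}\<close>, i.e. points of a
  product measure space.
\<close>

definition dball :: "('a \<Rightarrow> 'a \<Rightarrow> real) \<Rightarrow> 'a \<Rightarrow> real \<Rightarrow> 'a set" where
  "dball d x r = {y. d x y \<le> r}"

definition missing_mass ::
    "'a measure \<Rightarrow> ('a \<Rightarrow> 'a \<Rightarrow> real) \<Rightarrow> nat \<Rightarrow> real \<Rightarrow> (nat \<Rightarrow> 'a) \<Rightarrow> real" where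
  "missing_mass \<mu> d n r x = measure \<mu> (\<Inter>k\<in>{1..n}. - dball d (x k) r)"

definition good_turing ::
    "('a \<Rightarrow> 'a \<Rightarrow> real) \<Rightarrow> nat \<Rightarrow> real \<Rightarrow> (nat \<Rightarrow> 'a) \<Rightarrow> real" where
  "good_turing d n r x =
     (1 / real n) * (\<Sum>k = 1..n. indicator (\<Inter>i\<in>{1..n} - {k}. - dball d (x i) r) (x k))"

definition local_sep :: "('a \<Rightarrow> 'a \<Rightarrow> real) \<Rightarrow> real \<Rightarrow> 'a list \<Rightarrow> bool" where
  "local_sep d r xs \<longleftrightarrow>
     (\<exists>y. \<forall>i<length xs. d (xs ! i) y \<le> r) \<and>
     (\<forall>i j. i < j \<and> j < length xs \<longrightarrow> d (xs ! i) (xs ! j) > r)"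

text \<open>
  The empty subsequence is admitted; it never matters for \<open>n \<ge> 1\<close>, because every
  one-element sequence is locally separated as soon as \<open>d x x = 0 \<le> r\<close>.
\<close>

definition local_sep_number ::
    "('a \<Rightarrow> 'a \<Rightarrow> real) \<Rightarrow> nat \<Rightarrow> real \<Rightarrow> (nat \<Rightarrow> 'a) \<Rightarrow> nat" where
  "local_sep_number d n r x =
     Max {length ys | ys. subseq ys (map x [1..<Suc n]) \<and> local_sep d r ys}"

text \<open>
  The law of an i.i.d. sample \<open>(X\<^sub>1, \<dots>, X\<^sub>n)\<close>, as a complete measure. The completion is
  needed because locality is a projection (it quantifies over \<open>y\<close>), so that even on a Polish
  space the event that a sample is locally separated is in general only analytic: it is
  measurable for the completion but need not be in the product sigma-algebra. On the product
  sigma-algebra itself the completion changes neither probabilities nor expectations.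
\<close>

definition iid_sample :: "nat \<Rightarrow> 'a measure \<Rightarrow> (nat \<Rightarrow> 'a) measure" where
  "iid_sample n \<mu> = completion (PiM {1..n} (\<lambda>_. \<mu>))"

end

theory Submission
  imports Defs "HOL-Library.Nat_Bijection"
begin

text \<open>
  Both statistics satisfy a one-sided bound
  \<open>f x \<le> f y + (\<Sum>j. b j y * [x j \<noteq> y j])\<close> whose weights depend on \<open>y\<close> only. Such a bound
  tensorizes and gives \<open>E exp (l * (f - E f)) \<le> exp (l\<^sup>2 * E V / 2)\<close> together with the
  self-normalized \<open>E exp (l * (E f - f) - l\<^sup>2 * V / 2) \<le> 1\<close>, where \<open>V = (\<Sum>j. (b j)\<^sup>2)\<close>; the
  variance bound is the limit \<open>l \<rightarrow> 0\<close> of the first one. It remains to control \<open>V\<close>.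

  For the Good-Turing estimator, moving sample point \<open>j\<close> can only isolate pairwise separated
  points near it. For the missing mass, an uncovered point is charged to the sample points that
  covered it, evenly over all cyclic orderings of the sample; the weight of \<open>j\<close> is then the
  average compensator of the process that greedily selects separated points near \<open>j\<close>, so an
  exponential supermartingale bounds it by \<open>(h + t) / n\<close> up to constants. Finally \<open>h\<close> is itself
  self-bounding, which is the same lower tail estimate applied to \<open>- h\<close>.

  Measurability: \<open>{(x, y). d x y \<le> r}\<close> is replaced by a symmetric Borel relation that is almost
  everywhere equal to it, and a common neighbour of the selected points by a set of common
  neighbours of positive measure. A sample point is almost surely a common neighbour only of
  sets of points of the latter kind, so nothing is lost.
\<close>

section \<open>Bounded random variables\<close>

text \<open>Because the weights are read at \<open>y\<close> only, upper deviations see just the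
  mean of \<open>V\<close>, while lower deviations see \<open>V\<close> itself. Hence each statistic
  requires a mean bound and a tail bound for \<open>V\<close>. The cyclic averaging is forced: in a
  fixed order the point consulted first is charged the full mass of its ball, which may be close to
  1, whereas \<open>V\<close> has to be of order \<open>(h + ln n) / n\<close>. After averaging, the
  weight of \<open>j\<close> is a mean of conditional probabilities that the next point of the cycle
  lies near \<open>j\<close> and far from all points passed since \<open>j\<close>. The points for
  which this occurs are separated and share the neighbour \<open>j\<close>, so there are at most
  \<open>h\<close> of them. The term \<open>ln n\<close> is the price of a maximum over
  \<open>j\<close>: the weights sum to at most 1, so \<open>V\<close> is at most the largest weight.
  The measurable substitute for \<open>h\<close> is compared with \<open>h\<close> in one direction
  only; every final bound increases with the mean of \<open>h\<close>. The constants in the tail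
  bounds enter through their squares, with cross terms dropped, and leave ample room.\<close>

definition bounded_rv :: "'b measure \<Rightarrow> ('b \<Rightarrow> real) \<Rightarrow> bool" where
  "bounded_rv N f \<longleftrightarrow> f \<in> borel_measurable N \<and> (\<exists>B. \<forall>x\<in>space N. \<bar>f x\<bar> \<le> B)"

lemma bounded_rvI:
  assumes "f \<in> borel_measurable N" "\<And>x. x \<in> space N \<Longrightarrow> \<bar>f x\<bar> \<le> B"
  shows "bounded_rv N f"
  using assms unfolding bounded_rv_def by auto

lemma bounded_rv_measurable: "bounded_rv N f \<Longrightarrow> f \<in> borel_measurable N"
  by (simp add: bounded_rv_def)

lemma bounded_rvE:
  assumes "bounded_rv N f"
  obtains B where "0 \<le> B" "\<And>x. x \<in> space N \<Longrightarrow> \<bar>f x\<bar> \<le> B"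
proof -
  obtain B where B: "\<forall>x\<in>space N. \<bar>f x\<bar> \<le> B"
    using assms unfolding bounded_rv_def by auto
  show thesis
    by (rule that[of "max 0 B"]) (use B in force)+
qed

lemma bounded_rv_const: "bounded_rv N (\<lambda>_. c)"
  by (rule bounded_rvI[where B = "\<bar>c\<bar>"]) auto

lemma bounded_rv_add:
  assumes "bounded_rv N f" "bounded_rv N g" shows "bounded_rv N (\<lambda>x. f x + g x)"
proof -
  obtain B where "0 \<le> B" "\<And>x. x \<in> space N \<Longrightarrow> \<bar>f x\<bar> \<le> B"
    by (rule bounded_rvE[OF assms(1)]) blast
  moreover obtain C where "\<And>x. x \<in> space N \<Longrightarrow> \<bar>g x\<bar> \<le> C"
    by (rule bounded_rvE[OF assms(2)]) blast
  ultimately show ?thesis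
    using bounded_rv_measurable[OF assms(1)] bounded_rv_measurable[OF assms(2)]
    by (intro bounded_rvI[where B = "B + C"]) (auto intro: order_trans[OF abs_triangle_ineq] add_mono)
qed

lemma bounded_rv_mult:
  assumes "bounded_rv N f" "bounded_rv N g" shows "bounded_rv N (\<lambda>x. f x * g x)"
proof -
  obtain B where "0 \<le> B" "\<And>x. x \<in> space N \<Longrightarrow> \<bar>f x\<bar> \<le> B"
    by (rule bounded_rvE[OF assms(1)]) blast
  moreover obtain C where "\<And>x. x \<in> space N \<Longrightarrow> \<bar>g x\<bar> \<le> C"
    by (rule bounded_rvE[OF assms(2)]) blast
  ultimately show ?thesis
    using bounded_rv_measurable[OF assms(1)] bounded_rv_measurable[OF assms(2)]
    by (intro bounded_rvI[where B = "B * C"]) (auto simp: abs_mult intro: mult_mono)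
qed

lemma bounded_rv_uminus: "bounded_rv N f \<Longrightarrow> bounded_rv N (\<lambda>x. - f x)"
  unfolding bounded_rv_def by auto

lemma bounded_rv_diff: "bounded_rv N f \<Longrightarrow> bounded_rv N g \<Longrightarrow> bounded_rv N (\<lambda>x. f x - g x)"
  using bounded_rv_add[of N f "\<lambda>x. - g x"] bounded_rv_uminus[of N g] by simp

lemma bounded_rv_power: "bounded_rv N f \<Longrightarrow> bounded_rv N (\<lambda>x. f x ^ k)"
  by (induction k) (auto intro: bounded_rv_const bounded_rv_mult)

lemma bounded_rv_divide: "bounded_rv N f \<Longrightarrow> bounded_rv N (\<lambda>x. f x / c)"
  using bounded_rv_mult[OF _ bounded_rv_const, of N f "1 / c"] by simp

lemma bounded_rv_sum:
  "(\<And>j. j \<in> J \<Longrightarrow> bounded_rv N (f j)) \<Longrightarrow> bounded_rv N (\<lambda>x. \<Sum>j\<in>J. f j x)"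
  by (induction J rule: infinite_finite_induct) (auto intro: bounded_rv_const bounded_rv_add)

lemma bounded_rv_exp:
  assumes "bounded_rv N f" shows "bounded_rv N (\<lambda>x. exp (f x))"
proof -
  obtain B where B: "\<And>x. x \<in> space N \<Longrightarrow> \<bar>f x\<bar> \<le> B"
    by (rule bounded_rvE[OF assms]) blast
  show ?thesis
    using bounded_rv_measurable[OF assms]
    by (intro bounded_rvI[where B = "exp B"]) (auto dest!: B)
qed

text \<open>The bound is pointwise, not almost sure, so it survives composition with any measurable
  map. Fixing one coordinate of a sample is such a map, and it can turn a null set into one that is
  not null.\<close>

lemma bounded_rv_compose:
  assumes "bounded_rv N f" "g \<in> measurable K N" shows "bounded_rv K (\<lambda>x. f (g x))"
  using assms unfolding bounded_rv_def by (metis measurable_compose measurable_space)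

lemmas bounded_rv_intros =
  bounded_rv_const bounded_rv_add bounded_rv_mult bounded_rv_uminus bounded_rv_diff
  bounded_rv_power bounded_rv_divide bounded_rv_sum bounded_rv_exp

section \<open>Elementary exponential inequalities and the one-coordinate estimates\<close>

lemma exp_minus_le_quadratic:
  fixes m :: real
  assumes "0 \<le> m" shows "exp (- m) \<le> 1 - m + m\<^sup>2 / 2"
proof -
  have pos: "0 \<le> 1 - m + m\<^sup>2 / 2"
    using sum_squares_ge_zero[of "m - 1" 1] by (simp add: power2_eq_square algebra_simps)
  \<comment> \<open>The product equals \<open>1 + m^4 / 4\<close>.\<close>
  have "1 \<le> (1 - m + m\<^sup>2 / 2) * (1 + m + m\<^sup>2 / 2)"
    using assms by (simp add: power2_eq_square algebra_simps)
  also have "\<dots> \<le> (1 - m + m\<^sup>2 / 2) * exp m"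
    using exp_lower_Taylor_quadratic[OF assms] pos by (intro mult_left_mono) auto
  finally show ?thesis
    by (simp add: exp_minus field_simps)
qed

lemma exp_quadratic_le:
  fixes u :: real
  assumes "0 \<le> u" shows "exp (u - u\<^sup>2 / 2) \<le> 1 + u"
proof -
  have "ln (1 + 0) - 0 + 0\<^sup>2 / 2 \<le> ln (1 + u) - u + u\<^sup>2 / 2"
  proof (rule DERIV_nonneg_imp_nondecreasing[OF assms])
    fix x :: real assume "0 \<le> x" "x \<le> u"
    then show "\<exists>y. ((\<lambda>x. ln (1 + x) - x + x\<^sup>2 / 2) has_real_derivative y) (at x) \<and> 0 \<le> y"
      \<comment> \<open>The derivative is \<open>1 / (1 + x) - 1 + x\<close>.\<close>
      by (intro exI[of _ "x\<^sup>2 / (1 + x)"] conjI)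
         (auto intro!: derivative_eq_intros simp: field_simps power2_eq_square)
  qed
  then have "u - u\<^sup>2 / 2 \<le> ln (1 + u)" by simp
  then show ?thesis
    using assms by (metis add_pos_nonneg exp_le_cancel_iff exp_ln zero_less_one)
qed

context prob_space
begin

lemma integrable_bounded_rv:
  assumes "bounded_rv M f" shows "integrable M f"
proof -
  obtain B where "\<And>x. x \<in> space M \<Longrightarrow> \<bar>f x\<bar> \<le> B"
    by (rule bounded_rvE[OF assms]) blast
  then show ?thesis
    by (intro integrable_const_bound[where B = B] bounded_rv_measurable assms) auto
qed

lemma bounded_rv_integral:
  assumes "bounded_rv (N \<Otimes>\<^sub>M M) (\<lambda>(x, y). f x y)"
  shows "bounded_rv N (\<lambda>x. \<integral>y. f x y \<partial>M)"
proof -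
  obtain B where B: "0 \<le> B" "\<And>x. x \<in> space (N \<Otimes>\<^sub>M M) \<Longrightarrow> \<bar>case x of (x, y) \<Rightarrow> f x y\<bar> \<le> B"
    by (rule bounded_rvE[OF assms]) blast
  note [measurable] = bounded_rv_measurable[OF assms]
  show ?thesis
  proof (rule bounded_rvI[where B = B])
    show "(\<lambda>x. \<integral>y. f x y \<partial>M) \<in> borel_measurable N" by measurable
    fix x assume x: "x \<in> space N"
    have "bounded_rv M (f x)"
      using B x by (intro bounded_rvI[where B = B]) (auto simp: space_pair_measure)
    then have int: "integrable M (f x)"
      by (rule integrable_bounded_rv)
    have "\<bar>\<integral>y. f x y \<partial>M\<bar> \<le> (\<integral>y. \<bar>f x y\<bar> \<partial>M)"
      by (rule integral_abs_bound)
    also have "\<dots> \<le> (\<integral>y. B \<partial>M)"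
      using int B x by (intro integral_mono) (auto simp: space_pair_measure)
    finally show "\<bar>\<integral>y. f x y \<partial>M\<bar> \<le> B"
      by (simp add: prob_space)
  qed
qed

text \<open>Jensen's inequality, read off from the tangent of \<open>exp\<close> at the
  mean.\<close>

lemma exp_integral_le:
  assumes "bounded_rv M f" shows "exp (\<integral>x. f x \<partial>M) \<le> (\<integral>x. exp (f x) \<partial>M)"
proof -
  let ?m = "\<integral>x. f x \<partial>M"
  note int = integrable_bounded_rv[OF assms] integrable_bounded_rv[OF bounded_rv_exp[OF assms]]
  have "exp ?m * (1 + (f x - ?m)) \<le> exp (f x)" for x
  proof -
    have "exp ?m * (1 + (f x - ?m)) \<le> exp ?m * exp (f x - ?m)"
      by (intro mult_left_mono exp_ge_add_one_self) auto
    then show ?thesis by (simp flip: exp_add)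
  qed
  then have "(\<integral>x. exp ?m * (1 + (f x - ?m)) \<partial>M) \<le> (\<integral>x. exp (f x) \<partial>M)"
    using int by (intro integral_mono) auto
  then show ?thesis
    using int by (simp add: prob_space)
qed

text \<open>Every value is compared with the supremum \<open>s\<close> of \<open>a\<close>. Taking
  \<open>z = w\<close> gives \<open>ln (a w) <= B w\<close>, and letting \<open>z\<close> vary gives
  \<open>ln s <= B w + b w\<close>. Together they bound \<open>a w / s\<close> by
  \<open>1 + (B w + (b w)^2 / 2 - ln s)\<close>, which can be integrated before
  \<open>1 + u <= exp u\<close> restores the exponential.\<close>

lemma exp_moment_upper_single:
  assumes a: "bounded_rv M a" "\<And>z. z \<in> space M \<Longrightarrow> 0 < a z"
    and B: "bounded_rv M B" and b: "bounded_rv M b" "\<And>z. z \<in> space M \<Longrightarrow> 0 \<le> b z"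
    and le: "\<And>z w. z \<in> space M \<Longrightarrow> w \<in> space M \<Longrightarrow> a z \<le> exp (B w + b w * of_bool (z \<noteq> w))"
  shows "(\<integral>z. a z \<partial>M) \<le> exp (\<integral>w. B w + (b w)\<^sup>2 / 2 \<partial>M)"
proof -
  define s where "s = Sup (a ` space M)"
  obtain C where C: "\<And>x. x \<in> space M \<Longrightarrow> \<bar>a x\<bar> \<le> C"
    by (rule bounded_rvE[OF a(1)]) blast
  have bdd: "bdd_above (a ` space M)"
    by (rule bdd_aboveI[of _ C]) (use C in force)
  have a_le_s: "a z \<le> s" if "z \<in> space M" for z
    unfolding s_def using that bdd by (intro cSup_upper) auto
  have s: "0 < s"
    using a_le_s a(2) not_empty by force
  have s_le: "s \<le> exp (B w + b w)" if w: "w \<in> space M" for w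
    unfolding s_def
  proof (rule cSup_least)
    fix t assume "t \<in> a ` space M"
    then obtain z where z: "z \<in> space M" "t = a z" by auto
    have "exp (B w + b w * of_bool (z \<noteq> w)) \<le> exp (B w + b w)"
      using b(2)[OF w] by auto
    then show "t \<le> exp (B w + b w)"
      using le[OF z(1) w] z by linarith
  qed (use not_empty in auto)
  have pw: "a w \<le> s * (1 + (B w + (b w)\<^sup>2 / 2 - ln s))" if w: "w \<in> space M" for w
  proof -
    \<comment> \<open>The gap \<open>ln s - ln (a w)\<close> may exceed \<open>b w\<close>, since
      \<open>a w\<close> is bounded only from above. Truncation keeps \<open>m^2 <= (b w)^2\<close>,
      and \<open>- m <= B w - ln s\<close> holds whichever term attains the minimum.\<close>
    define m where "m = min (ln s - ln (a w)) (b w)"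
    have m0: "0 \<le> m"
      unfolding m_def using a_le_s[OF w] a(2)[OF w] b(2)[OF w] by (auto simp: ln_le_cancel_iff)
    have 1: "ln s \<le> B w + b w"
      using s_le[OF w] s by (metis exp_le_cancel_iff exp_ln)
    have 2: "ln (a w) \<le> B w"
      using le[OF w w] a(2)[OF w] by (metis add.right_neutral exp_le_cancel_iff exp_ln mult_zero_right of_bool_eq(1))
    have "m\<^sup>2 \<le> (b w)\<^sup>2"
      using m0 by (intro power_mono) (auto simp: m_def)
    then have c: "- m + m\<^sup>2 / 2 \<le> B w + (b w)\<^sup>2 / 2 - ln s"
      using 1 2 by (auto simp: m_def min_def split: if_splits)
    have "a w = s * exp (- (ln s - ln (a w)))"
      using s a(2)[OF w] by (simp add: exp_diff exp_minus)
    also have "\<dots> \<le> s * exp (- m)"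
      using s by (intro mult_left_mono) (auto simp: m_def)
    also have "\<dots> \<le> s * (1 + (B w + (b w)\<^sup>2 / 2 - ln s))"
      using s exp_minus_le_quadratic[OF m0] c by (intro mult_left_mono) auto
    finally show ?thesis .
  qed
  have int: "integrable M (\<lambda>w. B w + (b w)\<^sup>2 / 2)"
    by (intro integrable_bounded_rv bounded_rv_intros B b)
  have "(\<integral>z. a z \<partial>M) \<le> (\<integral>w. s * (1 + (B w + (b w)\<^sup>2 / 2 - ln s)) \<partial>M)"
    by (intro integral_mono integrable_bounded_rv bounded_rv_intros a B b pw)
  also have "\<dots> = s * (1 + ((\<integral>w. B w + (b w)\<^sup>2 / 2 \<partial>M) - ln s))"
    using int by (simp add: prob_space)
  also have "\<dots> \<le> s * exp ((\<integral>w. B w + (b w)\<^sup>2 / 2 \<partial>M) - ln s)"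
    using s by (intro mult_left_mono exp_ge_add_one_self) auto
  also have "\<dots> = exp (\<integral>w. B w + (b w)\<^sup>2 / 2 \<partial>M)"
    using s by (simp add: exp_diff)
  finally show ?thesis .
qed

text \<open>With \<open>S\<close> the supremum of \<open>f\<close>, letting \<open>f z\<close>
  approach \<open>S\<close> and choosing the best \<open>q\<close> for each \<open>w\<close> gives
  \<open>e w <= exp (- S) * (1 + (S - f w))\<close>. The right side is affine in \<open>f w\<close>,
  so integration and \<open>1 + x <= exp x\<close> finish.\<close>

lemma exp_moment_lower_single:
  assumes e: "bounded_rv M e" and f: "bounded_rv M f"
    and le: "\<And>z w q. z \<in> space M \<Longrightarrow> w \<in> space M \<Longrightarrow> 0 \<le> q \<Longrightarrow> q \<le> 1 \<Longrightarrow>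
      e w \<le> exp (q\<^sup>2 / 2 - (1 - q) * f w - q * f z)"
  shows "(\<integral>w. e w \<partial>M) \<le> exp (- (\<integral>w. f w \<partial>M))"
proof -
  define S where "S = Sup (f ` space M)"
  obtain C where C: "\<And>x. x \<in> space M \<Longrightarrow> \<bar>f x\<bar> \<le> C"
    by (rule bounded_rvE[OF f]) blast
  have bdd: "bdd_above (f ` space M)"
    by (rule bdd_aboveI[of _ C]) (use C in force)
  have f_le_S: "f z \<le> S" if "z \<in> space M" for z
    unfolding S_def using that bdd by (intro cSup_upper) auto
  have pw: "e w \<le> exp (- S) * (1 + (S - f w))" if w: "w \<in> space M" for w
  proof -
    define u where "u = S - f w"
    \<comment> \<open>This \<open>q\<close> minimises \<open>q^2 / 2 - q * u\<close> over the unit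
      interval.\<close>
    define q where "q = min u 1"
    have u: "0 \<le> u" using f_le_S[OF w] by (simp add: u_def)
    then have q: "0 \<le> q" "q \<le> 1" by (auto simp: q_def)
    show ?thesis
    proof (cases "e w \<le> 0")
      case True
      also have "0 \<le> exp (- S) * (1 + (S - f w))"
        using u by (simp add: u_def)
      finally show ?thesis .
    next
      case False
      define K where "K = q\<^sup>2 / 2 - (1 - q) * f w - ln (e w)"
      have K: "q * f z \<le> K" if "z \<in> space M" for z
      proof -
        have "ln (e w) \<le> q\<^sup>2 / 2 - (1 - q) * f w - q * f z"
          using le[OF that w q] False by (metis exp_ln exp_le_cancel_iff not_le)
        then show ?thesis by (simp add: K_def)
      qed
      \<comment> \<open>The supremum need not be attained, so \<open>q * f z <= K\<close> is divided
        by \<open>q\<close> before \<open>z\<close> is eliminated; hence the separate case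
        \<open>q = 0\<close>.\<close>
      have "q * S \<le> K"
      proof (cases "q = 0")
        case True
        then show ?thesis using K[OF w] by simp
      next
        case False
        then have q0: "0 < q" using q by simp
        have "S \<le> K / q"
          unfolding S_def using K q0 not_empty
          by (intro cSup_least) (auto simp: field_simps)
        then show ?thesis using q0 by (simp add: field_simps)
      qed
      then have "ln (e w) \<le> (u - q * u + q\<^sup>2 / 2) - S"
        by (simp add: K_def u_def algebra_simps)
      moreover have "exp (u - q * u + q\<^sup>2 / 2) \<le> 1 + u"
      proof (cases "u \<le> 1")
        case True
        then have "u - q * u + q\<^sup>2 / 2 = u - u\<^sup>2 / 2"
          by (simp add: q_def power2_eq_square)
        then show ?thesis using exp_quadratic_le[OF u] by (simp only:)
      next
        case False
        then have "u - q * u + q\<^sup>2 / 2 = 1 - 1\<^sup>2 / 2"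
          by (simp add: q_def)
        then have "exp (u - q * u + q\<^sup>2 / 2) = exp (1 - 1\<^sup>2 / 2)" by (simp only:)
        also have "\<dots> \<le> 1 + u" using exp_quadratic_le[of 1] False by simp
        finally show ?thesis .
      qed
      ultimately have "exp (- S) * exp (u - q * u + q\<^sup>2 / 2) \<le> exp (- S) * (1 + u)"
        and "exp (ln (e w)) \<le> exp (- S + (u - q * u + q\<^sup>2 / 2))"
        by (auto intro: mult_left_mono)
      then show ?thesis
        using False by (simp only: exp_add exp_ln not_le u_def)
    qed
  qed
  have int: "integrable M f" "integrable M e"
    by (intro integrable_bounded_rv e f)+
  have "(\<integral>w. e w \<partial>M) \<le> (\<integral>w. exp (- S) * (1 + (S - f w)) \<partial>M)"
    by (intro integral_mono integrable_bounded_rv bounded_rv_intros e f pw)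
  also have "\<dots> = exp (- S) * (1 + (S - (\<integral>w. f w \<partial>M)))"
    using int by (simp add: prob_space)
  also have "\<dots> \<le> exp (- S) * exp (S - (\<integral>w. f w \<partial>M))"
    by (intro mult_left_mono exp_ge_add_one_self) auto
  also have "\<dots> = exp (- (\<integral>w. f w \<partial>M))"
    by (simp flip: exp_add)
  finally show ?thesis .
qed

end

section \<open>Exponential moments under a weighted Hamming condition\<close>

context prob_space
begin

lemma prob_space_sample: "prob_space (PiM I (\<lambda>_. M))"
  by (intro prob_space_PiM) (rule prob_space_axioms)

lemma measurable_fun_upd_sample:
  "(\<lambda>(x, z). x(i := z)) \<in> measurable (PiM I (\<lambda>_. M) \<Otimes>\<^sub>M M) (PiM (insert i I) (\<lambda>_. M))"
  "(\<lambda>(z, x). x(i := z)) \<in> measurable (M \<Otimes>\<^sub>M PiM I (\<lambda>_. M)) (PiM (insert i I) (\<lambda>_. M))"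
  by (auto intro!: measurable_add_dim[THEN measurable_compose[OF measurable_pair_swap'], simplified case_prod_beta'] measurable_add_dim simp: case_prod_beta')

lemma measurable_fun_upd_section:
  assumes "z \<in> space M"
  shows "(\<lambda>x. x(i := z)) \<in> measurable (PiM I (\<lambda>_. M)) (PiM (insert i I) (\<lambda>_. M))"
  using measurable_compose[OF measurable_Pair2'[OF assms] measurable_fun_upd_sample(1)] by simp

text \<open>The new coordinate is outermost: the inner integral over \<open>I\<close> is the one to
  which an induction hypothesis applies, with \<open>z\<close> as a parameter.\<close>

lemma integral_sample_insert:
  fixes f :: "('i \<Rightarrow> 'a) \<Rightarrow> real"
  assumes I: "finite I" "i \<notin> I" and f: "bounded_rv (PiM (insert i I) (\<lambda>_. M)) f"
  shows "(\<integral>x. f x \<partial>PiM (insert i I) (\<lambda>_. M)) = (\<integral>z. (\<integral>x. f (x(i := z)) \<partial>PiM I (\<lambda>_. M)) \<partial>M)"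
proof -
  interpret S: product_prob_space "\<lambda>_. M" "insert i I" by standard
  interpret I: prob_space "PiM I (\<lambda>_. M)" by (rule prob_space_sample)
  interpret P: pair_prob_space "PiM I (\<lambda>_. M)" M ..
  have "bounded_rv (PiM I (\<lambda>_. M) \<Otimes>\<^sub>M M) (\<lambda>(x, z). f (x(i := z)))"
    using bounded_rv_compose[OF f measurable_fun_upd_sample(1)] by (simp add: case_prod_beta')
  then have "(\<integral>x. (\<integral>z. f (x(i := z)) \<partial>M) \<partial>PiM I (\<lambda>_. M)) = (\<integral>z. (\<integral>x. f (x(i := z)) \<partial>PiM I (\<lambda>_. M)) \<partial>M)"
    by (intro P.Fubini_integral[symmetric] P.integrable_bounded_rv)
  then show ?thesis
    by (subst S.product_integral_insert[OF I prob_space.integrable_bounded_rv[OF prob_space_sample f]])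
qed

lemma bounded_rv_sample_section:
  assumes "bounded_rv (PiM (insert i I) (\<lambda>_. M)) f" "z \<in> space M"
  shows "bounded_rv (PiM I (\<lambda>_. M)) (\<lambda>x. f (x(i := z)))"
  by (rule bounded_rv_compose[OF assms(1) measurable_fun_upd_section[OF assms(2)]])

lemma bounded_rv_sample_integral:
  assumes "bounded_rv (PiM (insert i I) (\<lambda>_. M)) f"
  shows "bounded_rv M (\<lambda>z. \<integral>x. f (x(i := z)) \<partial>PiM I (\<lambda>_. M))"
proof -
  interpret I: prob_space "PiM I (\<lambda>_. M)" by (rule prob_space_sample)
  show ?thesis
    using bounded_rv_compose[OF assms measurable_fun_upd_sample(2)]
    by (intro I.bounded_rv_integral) (simp add: case_prod_beta')
qed

text \<open>The opposite order: the inner integral is the conditional expectation given all other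
  coordinates, as the supermartingale argument requires.\<close>

lemma integral_sample_inner:
  fixes f :: "('i \<Rightarrow> 'a) \<Rightarrow> real"
  assumes "finite I" "i \<notin> I" "bounded_rv (PiM (insert i I) (\<lambda>_. M)) f"
  shows "(\<integral>y. f y \<partial>PiM (insert i I) (\<lambda>_. M)) = (\<integral>x. (\<integral>z. f (x(i := z)) \<partial>M) \<partial>PiM I (\<lambda>_. M))"
proof -
  interpret P: product_prob_space "\<lambda>_. M" "insert i I" by standard
  show ?thesis
    using P.product_integral_insert[OF assms(1,2)] assms(3) prob_space.integrable_bounded_rv[OF prob_space_sample]
    by blast
qed

lemma bounded_rv_sample_inner:
  fixes f :: "('i \<Rightarrow> 'a) \<Rightarrow> real"
  assumes "bounded_rv (PiM (insert i I) (\<lambda>_. M)) f"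
  shows "bounded_rv (PiM I (\<lambda>_. M)) (\<lambda>x. \<integral>z. f (x(i := z)) \<partial>M)"
  using bounded_rv_compose[OF assms measurable_fun_upd_sample(1)]
  by (intro bounded_rv_integral) (simp add: case_prod_beta')

lemma space_sample_fun_upd:
  "x \<in> space (PiM I (\<lambda>_. M)) \<Longrightarrow> z \<in> space M \<Longrightarrow> x(i := z) \<in> space (PiM (insert i I) (\<lambda>_. M))"
  by (auto simp: space_PiM PiE_def extensional_def)

lemma hamming_sum_insert:
  assumes "finite I" "i \<notin> I"
  shows "(\<Sum>j\<in>insert i I. b j (y(i := w)) * of_bool ((x(i := z)) j \<noteq> (y(i := w)) j) :: real) =
    b i (y(i := w)) * of_bool (z \<noteq> w) + (\<Sum>j\<in>I. b j (y(i := w)) * of_bool (x j \<noteq> y j))"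
  using assms by (auto intro!: sum.cong)

text \<open>The functions \<open>f\<close> and \<open>F\<close> are kept apart because the induction
  step sections \<open>f\<close> at \<open>z\<close> and \<open>F\<close> at \<open>w\<close>. The
  weight of coordinate \<open>i\<close> then joins \<open>F\<close>, the induction hypothesis yields
  exactly the premise of \<open>exp_moment_upper_single\<close>, and that lemma integrates out
  coordinate \<open>i\<close>.\<close>

theorem exp_moment_upper:
  fixes f F :: "('i \<Rightarrow> 'a) \<Rightarrow> real"
  assumes "finite I"
    and "bounded_rv (PiM I (\<lambda>_. M)) f" "bounded_rv (PiM I (\<lambda>_. M)) F"
    and "\<And>j. j \<in> I \<Longrightarrow> bounded_rv (PiM I (\<lambda>_. M)) (b j)"
    and "\<And>j x. j \<in> I \<Longrightarrow> x \<in> space (PiM I (\<lambda>_. M)) \<Longrightarrow> 0 \<le> b j x"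
    and "\<And>x y. x \<in> space (PiM I (\<lambda>_. M)) \<Longrightarrow> y \<in> space (PiM I (\<lambda>_. M)) \<Longrightarrow>
      f x \<le> F y + (\<Sum>j\<in>I. b j y * of_bool (x j \<noteq> y j))"
  shows "(\<integral>x. exp (f x) \<partial>PiM I (\<lambda>_. M)) \<le> exp (\<integral>y. F y + (\<Sum>j\<in>I. (b j y)\<^sup>2) / 2 \<partial>PiM I (\<lambda>_. M))"
  using assms
proof (induction I arbitrary: f F b rule: finite_induct)
  case empty
  interpret I: prob_space "PiM {} (\<lambda>_. M)" by (rule prob_space_sample)
  note int = I.integrable_bounded_rv
  have "f x \<le> F x" if "x \<in> space (PiM {} (\<lambda>_. M))" for x
    using empty.prems(5)[OF that that] by simp
  then show ?case
    by (simp add: PiM_empty lebesgue_integral_count_space_finite space_PiM)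
next
  case (insert i I)
  interpret I: prob_space "PiM I (\<lambda>_. M)" by (rule prob_space_sample)
  let ?N = "PiM I (\<lambda>_. M)"
  define a where "a z = (\<integral>x. exp (f (x(i := z))) \<partial>?N)" for z
  define B where "B z = (\<integral>y. F (y(i := z)) + (\<Sum>j\<in>I. (b j (y(i := z)))\<^sup>2) / 2 \<partial>?N)" for z
  define c where "c z = (\<integral>y. b i (y(i := z)) \<partial>?N)" for z
  note sect = bounded_rv_sample_section[OF insert.prems(1)] bounded_rv_sample_section[OF insert.prems(2)]
    bounded_rv_sample_section[OF insert.prems(3)]
  have bi: "bounded_rv (PiM (insert i I) (\<lambda>_. M)) (b i)" by (rule insert.prems(3)) simp
  have bounded:
    "bounded_rv (PiM (insert i I) (\<lambda>_. M)) (\<lambda>x. exp (f x))"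
    "bounded_rv (PiM (insert i I) (\<lambda>_. M)) (\<lambda>y. F y + (\<Sum>j\<in>I. (b j y)\<^sup>2) / 2)"
    "bounded_rv (PiM (insert i I) (\<lambda>_. M)) (\<lambda>y. F y + (\<Sum>j\<in>insert i I. (b j y)\<^sup>2) / 2)"
    "bounded_rv (PiM (insert i I) (\<lambda>_. M)) (\<lambda>y. (b i y)\<^sup>2)"
    by (intro bounded_rv_intros insert.prems(1-3); simp)+
  have a_pos: "0 < a z" if z: "z \<in> space M" for z
    unfolding a_def using I.exp_integral_le[OF sect(1)[OF z]] by (meson exp_gt_zero less_le_trans)
  have c_nonneg: "0 \<le> c z" if z: "z \<in> space M" for z
    unfolding c_def using insert.prems(4) z
    by (intro integral_nonneg_AE AE_I2) (auto intro: space_sample_fun_upd)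
  have le: "a z \<le> exp (B w + c w * of_bool (z \<noteq> w))" if z: "z \<in> space M" and w: "w \<in> space M" for z w
  proof -
    \<comment> \<open>Once \<open>z\<close> and \<open>w\<close> are fixed, this factor does not
      depend on \<open>y\<close>, so \<open>b i * k\<close> can be made part of
      \<open>F\<close>.\<close>
    define k where "k = (of_bool (z \<noteq> w) :: real)"
    have "a z \<le> exp (\<integral>y. (F (y(i := w)) + b i (y(i := w)) * k) + (\<Sum>j\<in>I. (b j (y(i := w)))\<^sup>2) / 2 \<partial>?N)"
      unfolding a_def
    proof (rule insert.IH)
      show "bounded_rv ?N (\<lambda>x. f (x(i := z)))" by (rule sect(1)[OF z])
      show "bounded_rv ?N (\<lambda>y. F (y(i := w)) + b i (y(i := w)) * k)"
        by (intro bounded_rv_add bounded_rv_mult bounded_rv_const sect(2) sect(3) w) simp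
      show "bounded_rv ?N (\<lambda>y. b j (y(i := w)))" if "j \<in> I" for j
        using that by (intro sect(3) w) simp
      show "0 \<le> b j (y(i := w))" if "j \<in> I" "y \<in> space ?N" for j y
        using that(1) by (intro insert.prems(4) space_sample_fun_upd that(2) w) simp
      show "f (x(i := z)) \<le> F (y(i := w)) + b i (y(i := w)) * k + (\<Sum>j\<in>I. b j (y(i := w)) * of_bool (x j \<noteq> y j))"
        if "x \<in> space ?N" "y \<in> space ?N" for x y
        using insert.prems(5)[OF space_sample_fun_upd[OF that(1) z] space_sample_fun_upd[OF that(2) w]]
        unfolding hamming_sum_insert[OF insert.hyps] k_def by (simp only: add.assoc)
    qed
    also have "(\<integral>y. (F (y(i := w)) + b i (y(i := w)) * k) + (\<Sum>j\<in>I. (b j (y(i := w)))\<^sup>2) / 2 \<partial>?N)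
      = (\<integral>y. (F (y(i := w)) + (\<Sum>j\<in>I. (b j (y(i := w)))\<^sup>2) / 2) + b i (y(i := w)) * k \<partial>?N)"
      by (simp add: algebra_simps)
    also have "\<dots> = B w + c w * k"
      unfolding B_def c_def
      using I.integrable_bounded_rv[OF bounded_rv_sample_section[OF bounded(2) w]]
        I.integrable_bounded_rv[OF bounded_rv_sample_section[OF bi w]]
      by (subst Bochner_Integration.integral_add) (auto simp del: fun_upd_apply)
    finally show ?thesis by (simp add: k_def)
  qed
  have "(\<integral>x. exp (f x) \<partial>PiM (insert i I) (\<lambda>_. M)) = (\<integral>z. a z \<partial>M)"
    unfolding a_def by (rule integral_sample_insert[OF insert.hyps bounded(1)])
  also have "\<dots> \<le> exp (\<integral>w. B w + (c w)\<^sup>2 / 2 \<partial>M)"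
  proof (rule exp_moment_upper_single)
    show "bounded_rv M a" unfolding a_def by (rule bounded_rv_sample_integral[OF bounded(1)])
    show "bounded_rv M B" unfolding B_def by (rule bounded_rv_sample_integral[OF bounded(2)])
    show "bounded_rv M c" unfolding c_def by (rule bounded_rv_sample_integral[OF bi])
  qed (use a_pos c_nonneg le in auto)
  also have "\<dots> \<le> exp (\<integral>w. (\<integral>y. F (y(i := w)) + (\<Sum>j\<in>insert i I. (b j (y(i := w)))\<^sup>2) / 2 \<partial>?N) \<partial>M)"
  proof -
    have pw: "B w + (c w)\<^sup>2 / 2 \<le> (\<integral>y. F (y(i := w)) + (\<Sum>j\<in>insert i I. (b j (y(i := w)))\<^sup>2) / 2 \<partial>?N)"
      if w: "w \<in> space M" for w
    proof -
      note ints = I.integrable_bounded_rv[OF bounded_rv_sample_section[OF bounded(2) w]]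
        I.integrable_bounded_rv[OF bounded_rv_sample_section[OF bounded(4) w]]
        I.integrable_bounded_rv[OF bounded_rv_sample_section[OF bi w]]
      \<comment> \<open>The one-coordinate estimate produces the square of an averaged weight;
        nonnegativity of a variance replaces it by the average of the square.\<close>
      have "0 \<le> (\<integral>y. (b i (y(i := w)) - c w)\<^sup>2 \<partial>?N)" by simp
      also have "\<dots> = (\<integral>y. (b i (y(i := w)))\<^sup>2 \<partial>?N) - (c w)\<^sup>2"
        using ints(2,3) unfolding c_def by (rule I.variance_eq[rotated])
      finally have "(c w)\<^sup>2 \<le> (\<integral>y. (b i (y(i := w)))\<^sup>2 \<partial>?N)" by simp
      moreover have "(\<integral>y. F (y(i := w)) + (\<Sum>j\<in>insert i I. (b j (y(i := w)))\<^sup>2) / 2 \<partial>?N)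
        = (\<integral>y. (F (y(i := w)) + (\<Sum>j\<in>I. (b j (y(i := w)))\<^sup>2) / 2) + (b i (y(i := w)))\<^sup>2 / 2 \<partial>?N)"
        using insert.hyps by (simp add: field_simps)
      moreover have "\<dots> = B w + (\<integral>y. (b i (y(i := w)))\<^sup>2 \<partial>?N) / 2"
        unfolding B_def using ints by (subst Bochner_Integration.integral_add) (auto simp del: fun_upd_apply)
      ultimately show ?thesis by linarith
    qed
    show ?thesis
      unfolding exp_le_cancel_iff
    proof (rule integral_mono)
      show "integrable M (\<lambda>w. B w + (c w)\<^sup>2 / 2)"
        unfolding B_def c_def
        by (intro integrable_bounded_rv bounded_rv_add bounded_rv_divide bounded_rv_power
            bounded_rv_sample_integral[OF bounded(2)] bounded_rv_sample_integral[OF bi])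
      show "integrable M (\<lambda>w. \<integral>y. F (y(i := w)) + (\<Sum>j\<in>insert i I. (b j (y(i := w)))\<^sup>2) / 2 \<partial>?N)"
        by (intro integrable_bounded_rv bounded_rv_sample_integral[OF bounded(3)])
    qed (use pw in auto)
  qed
  also have "\<dots> = exp (\<integral>y. F y + (\<Sum>j\<in>insert i I. (b j y)\<^sup>2) / 2 \<partial>PiM (insert i I) (\<lambda>_. M))"
    by (subst integral_sample_insert[OF insert.hyps bounded(3)]) simp
  finally show ?case .
qed

text \<open>Here the squared weights stay inside the exponential, so they cannot be averaged
  afterwards as in \<open>exp_moment_upper\<close>. The induction hypothesis is applied to a mixture
  of the sections of \<open>f\<close> at \<open>w\<close> and \<open>z\<close>. The extra term
  \<open>q * b i\<close> is at most \<open>(b i)^2 / 2 + q^2 / 2\<close>, whose first part is what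
  the exponent already holds for coordinate \<open>i\<close>. Since \<open>q\<close> is free,
  \<open>exp_moment_lower_single\<close> can optimise it.\<close>

theorem exp_moment_lower:
  fixes f F :: "('i \<Rightarrow> 'a) \<Rightarrow> real"
  assumes "finite I"
    and "bounded_rv (PiM I (\<lambda>_. M)) f" "bounded_rv (PiM I (\<lambda>_. M)) F"
    and "\<And>j. j \<in> I \<Longrightarrow> bounded_rv (PiM I (\<lambda>_. M)) (b j)"
    and "\<And>j x. j \<in> I \<Longrightarrow> x \<in> space (PiM I (\<lambda>_. M)) \<Longrightarrow> 0 \<le> b j x"
    and "\<And>x y. x \<in> space (PiM I (\<lambda>_. M)) \<Longrightarrow> y \<in> space (PiM I (\<lambda>_. M)) \<Longrightarrow>
      f x \<le> F y + (\<Sum>j\<in>I. b j y * of_bool (x j \<noteq> y j))"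
  shows "(\<integral>y. exp (- (F y + (\<Sum>j\<in>I. (b j y)\<^sup>2) / 2)) \<partial>PiM I (\<lambda>_. M)) \<le> exp (- (\<integral>x. f x \<partial>PiM I (\<lambda>_. M)))"
  using assms
proof (induction I arbitrary: f F b rule: finite_induct)
  case empty
  have "f x \<le> F x" if "x \<in> space (PiM {} (\<lambda>_. M))" for x
    using empty.prems(5)[OF that that] by simp
  then show ?case
    by (simp add: PiM_empty lebesgue_integral_count_space_finite space_PiM)
next
  case (insert i I)
  interpret I: prob_space "PiM I (\<lambda>_. M)" by (rule prob_space_sample)
  let ?N = "PiM I (\<lambda>_. M)"
  define e where "e z = (\<integral>y. exp (- (F (y(i := z)) + (\<Sum>j\<in>insert i I. (b j (y(i := z)))\<^sup>2) / 2)) \<partial>?N)" for z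
  define g where "g z = (\<integral>x. f (x(i := z)) \<partial>?N)" for z
  note sect = bounded_rv_sample_section[OF insert.prems(1)] bounded_rv_sample_section[OF insert.prems(2)]
    bounded_rv_sample_section[OF insert.prems(3)]
  have bounded:
    "bounded_rv (PiM (insert i I) (\<lambda>_. M)) (\<lambda>y. exp (- (F y + (\<Sum>j\<in>insert i I. (b j y)\<^sup>2) / 2)))"
    by (intro bounded_rv_intros insert.prems(1-3); simp)
  have le: "e w \<le> exp (q\<^sup>2 / 2 - (1 - q) * g w - q * g z)"
    if z: "z \<in> space M" and w: "w \<in> space M" and q: "0 \<le> q" "q \<le> 1" for z w q
  proof -
    \<comment> \<open>The convex combination trades the weight of coordinate \<open>i\<close> for the constant \<open>q\<^sup>2 / 2\<close>.\<close>
    define f' where "f' x = (1 - q) * f (x(i := w)) + q * f (x(i := z))" for x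
    define F' where "F' y = F (y(i := w)) + (b i (y(i := w)))\<^sup>2 / 2 + q\<^sup>2 / 2" for y
    have "(\<integral>y. exp (- (F' y + (\<Sum>j\<in>I. (b j (y(i := w)))\<^sup>2) / 2)) \<partial>?N) \<le> exp (- (\<integral>x. f' x \<partial>?N))"
    proof (rule insert.IH)
      show "bounded_rv ?N f'"
        unfolding f'_def by (intro bounded_rv_add bounded_rv_mult bounded_rv_const sect(1) z w)
      show "bounded_rv ?N F'"
        unfolding F'_def
        by (intro bounded_rv_add bounded_rv_divide bounded_rv_power bounded_rv_const sect(2) sect(3) w) simp
      show "bounded_rv ?N (\<lambda>y. b j (y(i := w)))" if "j \<in> I" for j
        using that by (intro sect(3) w) simp
      show "0 \<le> b j (y(i := w))" if "j \<in> I" "y \<in> space ?N" for j y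
        using that(1) by (intro insert.prems(4) space_sample_fun_upd that(2) w) simp
      show "f' x \<le> F' y + (\<Sum>j\<in>I. b j (y(i := w)) * of_bool (x j \<noteq> y j))"
        if "x \<in> space ?N" "y \<in> space ?N" for x y
      proof -
        let ?s = "\<Sum>j\<in>I. b j (y(i := w)) * of_bool (x j \<noteq> y j)" and ?b = "b i (y(i := w))"
        have 1: "f (x(i := w)) \<le> F (y(i := w)) + ?s"
          using insert.prems(5)[OF space_sample_fun_upd[OF that(1) w] space_sample_fun_upd[OF that(2) w]]
          unfolding hamming_sum_insert[OF insert.hyps] by (simp only: refl not_True_eq_False of_bool_eq mult_zero_right add_0)
        have 2: "q * f (x(i := z)) \<le> q * (F (y(i := w)) + ?s) + q * ?b"
        proof (cases "z = w")
          case True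
          have "q * f (x(i := w)) \<le> q * (F (y(i := w)) + ?s)"
            using 1 q by (intro mult_left_mono)
          moreover have "0 \<le> q * ?b"
            using q by (intro mult_nonneg_nonneg insert.prems(4) space_sample_fun_upd that(2) w) simp_all
          ultimately show ?thesis using True by simp
        next
          case False
          then have "f (x(i := z)) \<le> F (y(i := w)) + (?b + ?s)"
            using insert.prems(5)[OF space_sample_fun_upd[OF that(1) z] space_sample_fun_upd[OF that(2) w]]
            unfolding hamming_sum_insert[OF insert.hyps] by (simp only: not_False_eq_True of_bool_eq mult_1_right)
          then have "q * f (x(i := z)) \<le> q * (F (y(i := w)) + (?b + ?s))"
            using q by (intro mult_left_mono)
          then show ?thesis by (simp add: algebra_simps)
        qed
        have "(1 - q) * f (x(i := w)) \<le> (1 - q) * (F (y(i := w)) + ?s)"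
          using 1 q by (intro mult_left_mono) auto
        moreover have "q * ?b \<le> ?b\<^sup>2 / 2 + q\<^sup>2 / 2"
          using sum_squares_bound[of q ?b] by simp
        ultimately show ?thesis
          using 2 unfolding f'_def F'_def by (simp add: algebra_simps)
      qed
    qed
    also have "(\<integral>x. f' x \<partial>?N) = (1 - q) * g w + q * g z"
      unfolding f'_def g_def
      using I.integrable_bounded_rv[OF sect(1)[OF z]] I.integrable_bounded_rv[OF sect(1)[OF w]]
      by (subst Bochner_Integration.integral_add) (auto simp del: fun_upd_apply)
    also have "(\<integral>y. exp (- (F' y + (\<Sum>j\<in>I. (b j (y(i := w)))\<^sup>2) / 2)) \<partial>?N)
      = (\<integral>y. exp (- (F (y(i := w)) + (\<Sum>j\<in>insert i I. (b j (y(i := w)))\<^sup>2) / 2)) * exp (- (q\<^sup>2 / 2)) \<partial>?N)"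
      unfolding F'_def using insert.hyps
      by (intro Bochner_Integration.integral_cong refl) (simp add: field_simps flip: exp_add)
    also have "\<dots> = e w * exp (- (q\<^sup>2 / 2))"
      unfolding e_def by simp
    finally have "e w * exp (- (q\<^sup>2 / 2)) * exp (q\<^sup>2 / 2) \<le> exp (- ((1 - q) * g w + q * g z)) * exp (q\<^sup>2 / 2)"
      by (intro mult_right_mono) auto
    then show ?thesis
      by (simp add: mult.assoc algebra_simps flip: exp_add)
  qed
  have "(\<integral>y. exp (- (F y + (\<Sum>j\<in>insert i I. (b j y)\<^sup>2) / 2)) \<partial>PiM (insert i I) (\<lambda>_. M)) = (\<integral>z. e z \<partial>M)"
    unfolding e_def by (rule integral_sample_insert[OF insert.hyps bounded(1)])
  also have "\<dots> \<le> exp (- (\<integral>w. g w \<partial>M))"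
  proof (rule exp_moment_lower_single)
    show "bounded_rv M e" unfolding e_def by (rule bounded_rv_sample_integral[OF bounded(1)])
    show "bounded_rv M g" unfolding g_def by (rule bounded_rv_sample_integral[OF insert.prems(1)])
  qed (rule le)
  also have "(\<integral>w. g w \<partial>M) = (\<integral>x. f x \<partial>PiM (insert i I) (\<lambda>_. M))"
    unfolding g_def by (rule integral_sample_insert[OF insert.hyps insert.prems(1), symmetric])
  finally show ?case .
qed

end

section \<open>Variance and tail bounds from exponential moments\<close>

lemma exp_ge_cubic:
  fixes x :: real
  shows "1 + x + x\<^sup>2 / 2 + x ^ 3 / 6 \<le> exp x"
proof -
  obtain t where "exp x = (\<Sum>m<4. x ^ m / fact m) + exp t / fact 4 * x ^ 4"
    using Maclaurin_exp_le[of x 4] by auto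
  moreover have "(\<Sum>m<4. x ^ m / fact m) = 1 + x + x\<^sup>2 / 2 + x ^ 3 / 6"
    by (simp add: eval_nat_numeral)
  \<comment> \<open>The remainder has even order, hence no sign condition on
    \<open>x\<close>.\<close>
  moreover have "0 \<le> exp t / fact 4 * x ^ 4"
    by (intro mult_nonneg_nonneg) auto
  ultimately show ?thesis by linarith
qed

context prob_space
begin

text \<open>Second-order terms are compared as \<open>l\<close> tends to 0. The cubic lower bound
  for \<open>exp\<close> costs at most \<open>K^3\<close>, and the mean is zero, so division by
  \<open>l^2 / 2\<close> leaves an error of order \<open>l\<close>.\<close>

lemma variance_le_of_exp_moment:
  assumes X: "bounded_rv M X" and mean: "(\<integral>x. X x \<partial>M) = 0" and v: "0 \<le> v"
    and exp_moment: "\<And>l. 0 < l \<Longrightarrow> (\<integral>x. exp (l * X x) \<partial>M) \<le> exp (l\<^sup>2 * v / 2)"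
  shows "(\<integral>x. (X x)\<^sup>2 \<partial>M) \<le> v"
proof -
  obtain K where K: "0 \<le> K" "\<And>x. x \<in> space M \<Longrightarrow> \<bar>X x\<bar> \<le> K"
    by (rule bounded_rvE[OF X]) blast
  let ?S = "\<integral>x. (X x)\<^sup>2 \<partial>M"
  \<comment> \<open>The restrictions on \<open>l\<close> ensure \<open>l^2 * v / 2 <= 1\<close>,
    which the quadratic upper bound for \<open>exp\<close> requires.\<close>
  have bound: "?S \<le> v + l * (K ^ 3 / 3) + l\<^sup>2 * v\<^sup>2 / 2" if l: "0 < l" "l < 1" "l < 1 / (1 + v)" for l
  proof -
    have "1 + l\<^sup>2 / 2 * ?S - l ^ 3 * K ^ 3 / 6 = (\<integral>x. 1 + l * X x + l\<^sup>2 / 2 * (X x)\<^sup>2 - l ^ 3 * K ^ 3 / 6 \<partial>M)"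
      using integrable_bounded_rv[OF X] integrable_bounded_rv[OF bounded_rv_power[OF X, of 2]] mean
      by (simp add: prob_space)
    also have "\<dots> \<le> (\<integral>x. exp (l * X x) \<partial>M)"
    proof (intro integral_mono integrable_bounded_rv bounded_rv_diff bounded_rv_add bounded_rv_mult
        bounded_rv_const bounded_rv_exp bounded_rv_power X)
      fix x assume x: "x \<in> space M"
      have "\<bar>l * X x\<bar> ^ 3 \<le> (l * K) ^ 3"
        using K(2)[OF x] l by (intro power_mono) (auto simp: abs_mult)
      then have "- ((l * K) ^ 3) \<le> (l * X x) ^ 3"
        by (simp flip: power_abs)
      then show "1 + l * X x + l\<^sup>2 / 2 * (X x)\<^sup>2 - l ^ 3 * K ^ 3 / 6 \<le> exp (l * X x)"
        using exp_ge_cubic[of "l * X x"] by (simp add: power_mult_distrib)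
    qed
    also have "\<dots> \<le> exp (l\<^sup>2 * v / 2)"
      using exp_moment l by simp
    also have "\<dots> \<le> 1 + l\<^sup>2 * v / 2 + (l\<^sup>2 * v / 2)\<^sup>2"
    proof (rule exp_bound)
      have "l * v \<le> 1"
        using l v by (simp add: field_simps)
      then have "l * (l * v) \<le> 1 * 1"
        using l v by (intro mult_mono) auto
      then show "l\<^sup>2 * v / 2 \<le> 1" by (simp add: power2_eq_square mult.assoc)
    qed (use v in auto)
    finally have "l\<^sup>2 / 2 * ?S \<le> l\<^sup>2 / 2 * (v + l * (K ^ 3 / 3) + l\<^sup>2 * v\<^sup>2 / 2)"
      by (simp add: algebra_simps power2_eq_square power3_eq_cube)
    then show ?thesis
      by (rule mult_left_le_imp_le) (use l in auto)
  qed
  have "((\<lambda>l. v + l * (K ^ 3 / 3) + l\<^sup>2 * v\<^sup>2 / 2) \<longlongrightarrow> v + 0 * (K ^ 3 / 3) + 0\<^sup>2 * v\<^sup>2 / 2) (at_right 0)"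
    by (intro tendsto_intros) auto
  moreover have "eventually (\<lambda>l. ?S \<le> v + l * (K ^ 3 / 3) + l\<^sup>2 * v\<^sup>2 / 2) (at_right 0)"
    unfolding eventually_at_right_field
  proof (intro exI[of _ "min 1 (1 / (1 + v))"] conjI allI impI)
    show "0 < min 1 (1 / (1 + v))" using v by simp
    fix l assume "0 < l" "l < min 1 (1 / (1 + v))"
    then show "?S \<le> v + l * (K ^ 3 / 3) + l\<^sup>2 * v\<^sup>2 / 2"
      by (intro bound) linarith+
  qed
  ultimately have "?S \<le> v + 0 * (K ^ 3 / 3) + 0\<^sup>2 * v\<^sup>2 / 2"
    by (intro tendsto_lowerbound[where F = "at_right 0"]) auto
  then show ?thesis by simp
qed

text \<open>Chernoff's bound on the event \<open>W x <= v\<close>, where the random normaliser may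
  be replaced by the constant \<open>v\<close>.\<close>

lemma self_normalized_tail:
  assumes X: "bounded_rv M X" and W: "bounded_rv M W"
    and exp_moment: "\<And>l. 0 < l \<Longrightarrow> (\<integral>x. exp (l * X x - l\<^sup>2 * W x / 2) \<partial>M) \<le> 1"
    and v: "0 < v" and s: "0 < s" "2 * v * t \<le> s\<^sup>2"
  shows "prob {x \<in> space M. s < X x} \<le> exp (- t) + prob {x \<in> space M. v < W x}"
proof -
  note [measurable] = bounded_rv_measurable[OF X] bounded_rv_measurable[OF W]
  \<comment> \<open>The minimiser of \<open>l^2 * v / 2 - l * s\<close>.\<close>
  define l where "l = s / v"
  have l: "0 < l" using v s by (simp add: l_def)
  define E where "E x = exp (l * X x - l\<^sup>2 * W x / 2) * exp (l\<^sup>2 * v / 2 - l * s)" for x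
  have bE: "bounded_rv M E"
    unfolding E_def by (intro bounded_rv_intros X W)
  have "prob {x \<in> space M. s < X x \<and> W x \<le> v} = (\<integral>x. indicator {x \<in> space M. s < X x \<and> W x \<le> v} x \<partial>M)"
    by simp
  also have "\<dots> \<le> (\<integral>x. E x \<partial>M)"
  proof (intro integral_mono integrable_bounded_rv bE)
    show "bounded_rv M (indicator {x \<in> space M. s < X x \<and> W x \<le> v})"
      by (intro bounded_rvI[where B = 1]) (auto simp: indicator_def)
    fix x assume "x \<in> space M"
    show "indicator {x \<in> space M. s < X x \<and> W x \<le> v} x \<le> E x"
    proof (cases "s < X x \<and> W x \<le> v")
      case True
      have "l * s \<le> l * X x" "l\<^sup>2 * W x \<le> l\<^sup>2 * v"
        using True l by auto
      then have "0 \<le> l * X x - l\<^sup>2 * W x / 2 + (l\<^sup>2 * v / 2 - l * s)" by simp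
      then have "1 \<le> E x" unfolding E_def by (simp flip: exp_add)
      then show ?thesis by (auto simp: indicator_def)
    qed (auto simp: E_def)
  qed
  also have "\<dots> \<le> 1 * exp (l\<^sup>2 * v / 2 - l * s)"
    unfolding E_def using exp_moment[OF l] by simp
  also have "\<dots> \<le> exp (- t)"
  proof -
    have "l\<^sup>2 * v / 2 - l * s = - (s\<^sup>2 / (2 * v))"
      using v by (simp add: l_def field_simps power2_eq_square)
    moreover have "t \<le> s\<^sup>2 / (2 * v)"
      using s v by (simp add: field_simps)
    ultimately show ?thesis by simp
  qed
  finally have "prob {x \<in> space M. s < X x \<and> W x \<le> v} \<le> exp (- t)" .
  moreover have "prob {x \<in> space M. s < X x} \<le> prob ({x \<in> space M. s < X x \<and> W x \<le> v} \<union> {x \<in> space M. v < W x})"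
    by (intro finite_measure_mono) auto
  moreover have "\<dots> \<le> prob {x \<in> space M. s < X x \<and> W x \<le> v} + prob {x \<in> space M. v < W x}"
    by (intro measure_Un_le) auto
  ultimately show ?thesis by linarith
qed

text \<open>The asymmetric Lipschitz condition of Talagrand's convex distance method: the weights
  may vary with the point on the right, but not with \<open>x\<close>.\<close>

definition hamming_lipschitz :: "'i set \<Rightarrow> (('i \<Rightarrow> 'a) \<Rightarrow> real) \<Rightarrow> ('i \<Rightarrow> ('i \<Rightarrow> 'a) \<Rightarrow> real) \<Rightarrow> bool" where
  "hamming_lipschitz I f b \<longleftrightarrow> finite I \<and> bounded_rv (PiM I (\<lambda>_. M)) f \<and>
    (\<forall>j\<in>I. bounded_rv (PiM I (\<lambda>_. M)) (b j) \<and> (\<forall>x\<in>space (PiM I (\<lambda>_. M)). 0 \<le> b j x)) \<and>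
    (\<forall>x\<in>space (PiM I (\<lambda>_. M)). \<forall>y\<in>space (PiM I (\<lambda>_. M)).
      f x \<le> f y + (\<Sum>j\<in>I. b j y * of_bool (x j \<noteq> y j)))"

lemma hamming_lipschitz_bounded:
  assumes "hamming_lipschitz I f b"
  shows "bounded_rv (PiM I (\<lambda>_. M)) f" "bounded_rv (PiM I (\<lambda>_. M)) (\<lambda>x. \<Sum>j\<in>I. (b j x)\<^sup>2)"
  using assms by (auto simp: hamming_lipschitz_def intro!: bounded_rv_sum bounded_rv_power)

lemma hamming_lipschitz_exp_moments:
  assumes "hamming_lipschitz I f b" "0 \<le> l"
  shows "(\<integral>x. exp (l * f x) \<partial>PiM I (\<lambda>_. M)) \<le>
      exp (l * (\<integral>x. f x \<partial>PiM I (\<lambda>_. M)) + l\<^sup>2 * (\<integral>x. (\<Sum>j\<in>I. (b j x)\<^sup>2) \<partial>PiM I (\<lambda>_. M)) / 2)"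
    and "(\<integral>x. exp (- (l * f x + l\<^sup>2 * (\<Sum>j\<in>I. (b j x)\<^sup>2) / 2)) \<partial>PiM I (\<lambda>_. M)) \<le>
      exp (- (l * (\<integral>x. f x \<partial>PiM I (\<lambda>_. M))))"
proof -
  interpret I: prob_space "PiM I (\<lambda>_. M)" by (rule prob_space_sample)
  let ?N = "PiM I (\<lambda>_. M)"
  note f = assms(1)[unfolded hamming_lipschitz_def]
  have I: "finite I" and lf: "bounded_rv ?N (\<lambda>x. l * f x)"
    and lb: "\<And>j. j \<in> I \<Longrightarrow> bounded_rv ?N (\<lambda>x. l * b j x)"
    and lb0: "\<And>j x. j \<in> I \<Longrightarrow> x \<in> space ?N \<Longrightarrow> 0 \<le> l * b j x"
    using f assms(2) by (auto intro: bounded_rv_mult bounded_rv_const)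
  have le: "l * f x \<le> l * f y + (\<Sum>j\<in>I. (l * b j y) * of_bool (x j \<noteq> y j))"
    if "x \<in> space ?N" "y \<in> space ?N" for x y
  proof -
    have "l * f x \<le> l * (f y + (\<Sum>j\<in>I. b j y * of_bool (x j \<noteq> y j)))"
      using f that assms(2) by (intro mult_left_mono) auto
    then show ?thesis by (simp add: algebra_simps sum_distrib_left)
  qed
  have sq: "(\<Sum>j\<in>I. (l * b j y)\<^sup>2) = l\<^sup>2 * (\<Sum>j\<in>I. (b j y)\<^sup>2)" for y
    by (simp add: power_mult_distrib sum_distrib_left)
  have int: "integrable ?N f" "integrable ?N (\<lambda>x. \<Sum>j\<in>I. (b j x)\<^sup>2)"
    using hamming_lipschitz_bounded[OF assms(1)] by (auto intro: I.integrable_bounded_rv)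
  show "(\<integral>x. exp (l * f x) \<partial>PiM I (\<lambda>_. M)) \<le>
      exp (l * (\<integral>x. f x \<partial>PiM I (\<lambda>_. M)) + l\<^sup>2 * (\<integral>x. (\<Sum>j\<in>I. (b j x)\<^sup>2) \<partial>PiM I (\<lambda>_. M)) / 2)"
    using exp_moment_upper[where b = "\<lambda>j x. l * b j x", OF I lf lf lb lb0 le] int unfolding sq by simp
  show "(\<integral>x. exp (- (l * f x + l\<^sup>2 * (\<Sum>j\<in>I. (b j x)\<^sup>2) / 2)) \<partial>PiM I (\<lambda>_. M)) \<le>
      exp (- (l * (\<integral>x. f x \<partial>PiM I (\<lambda>_. M))))"
    using exp_moment_lower[where b = "\<lambda>j x. l * b j x", OF I lf lf lb lb0 le] unfolding sq by simp
qed

lemma hamming_lipschitz_variance: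
  assumes "hamming_lipschitz I f b"
  shows "(\<integral>x. (f x - (\<integral>x. f x \<partial>PiM I (\<lambda>_. M)))\<^sup>2 \<partial>PiM I (\<lambda>_. M)) \<le>
    (\<integral>x. (\<Sum>j\<in>I. (b j x)\<^sup>2) \<partial>PiM I (\<lambda>_. M))"
proof -
  interpret I: prob_space "PiM I (\<lambda>_. M)" by (rule prob_space_sample)
  note bd = hamming_lipschitz_bounded[OF assms]
  show ?thesis
  proof (rule I.variance_le_of_exp_moment)
    show "bounded_rv (PiM I (\<lambda>_. M)) (\<lambda>x. f x - (\<integral>x. f x \<partial>PiM I (\<lambda>_. M)))"
      by (intro bounded_rv_diff bd bounded_rv_const)
    show "(\<integral>x. f x - (\<integral>x. f x \<partial>PiM I (\<lambda>_. M)) \<partial>PiM I (\<lambda>_. M)) = 0"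
      using I.integrable_bounded_rv[OF bd(1)] by (simp add: I.prob_space)
    show "0 \<le> (\<integral>x. (\<Sum>j\<in>I. (b j x)\<^sup>2) \<partial>PiM I (\<lambda>_. M))"
      by (simp add: sum_nonneg)
    fix l :: real assume "0 < l"
    let ?m = "\<integral>x. f x \<partial>PiM I (\<lambda>_. M)" and ?v = "\<integral>x. (\<Sum>j\<in>I. (b j x)\<^sup>2) \<partial>PiM I (\<lambda>_. M)"
    have "(\<integral>x. exp (l * (f x - ?m)) \<partial>PiM I (\<lambda>_. M)) = (\<integral>x. exp (l * f x) \<partial>PiM I (\<lambda>_. M)) * exp (- (l * ?m))"
      by (simp add: right_diff_distrib exp_diff exp_minus divide_inverse)
    also have "\<dots> \<le> exp (l * ?m + l\<^sup>2 * ?v / 2) * exp (- (l * ?m))"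
      using hamming_lipschitz_exp_moments(1)[OF assms, of l] \<open>0 < l\<close> by (intro mult_right_mono) auto
    also have "\<dots> = exp (l\<^sup>2 * ?v / 2)"
      by (simp flip: exp_add)
    finally show "(\<integral>x. exp (l * (f x - ?m)) \<partial>PiM I (\<lambda>_. M)) \<le> exp (l\<^sup>2 * ?v / 2)" .
  qed
qed

text \<open>Two variance proxies appear: \<open>v\<close> dominates the mean of the squared weights
  and serves the upper tail; \<open>w\<close> dominates the squared weights themselves off an
  exceptional event and serves the lower tail.\<close>

lemma hamming_lipschitz_tails:
  assumes f: "hamming_lipschitz I f b" and s: "0 < s"
    and mean: "(\<integral>x. (\<Sum>j\<in>I. (b j x)\<^sup>2) \<partial>PiM I (\<lambda>_. M)) \<le> v" "0 < v" "2 * v * t \<le> s\<^sup>2"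
    and w: "0 < w" "2 * w * t \<le> s\<^sup>2"
  shows "measure (PiM I (\<lambda>_. M)) {x \<in> space (PiM I (\<lambda>_. M)). s < \<bar>f x - (\<integral>x. f x \<partial>PiM I (\<lambda>_. M))\<bar>}
    \<le> 2 * exp (- t) + measure (PiM I (\<lambda>_. M)) {x \<in> space (PiM I (\<lambda>_. M)). w < (\<Sum>j\<in>I. (b j x)\<^sup>2)}"
proof -
  interpret I: prob_space "PiM I (\<lambda>_. M)" by (rule prob_space_sample)
  let ?N = "PiM I (\<lambda>_. M)" and ?V = "\<lambda>x. \<Sum>j\<in>I. (b j x)\<^sup>2"
  note bd = hamming_lipschitz_bounded[OF f]
  note [measurable] = bd[THEN bounded_rv_measurable]
  let ?m = "\<integral>x. f x \<partial>?N"
  \<comment> \<open>The normaliser is the constant \<open>v\<close>, so the exceptional event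
    \<open>v < v\<close> is empty.\<close>
  have "I.prob {x \<in> space ?N. s < f x - ?m} \<le> exp (- t) + I.prob {x \<in> space ?N. v < v}"
  proof (rule I.self_normalized_tail[OF _ bounded_rv_const _ mean(2) s mean(3)])
    show "bounded_rv ?N (\<lambda>x. f x - ?m)"
      by (intro bounded_rv_diff bd bounded_rv_const)
    fix l :: real assume l: "0 < l"
    have "(\<integral>x. exp (l * f x) \<partial>?N) \<le> exp (l * ?m + l\<^sup>2 * v / 2)"
    proof (rule order_trans[OF hamming_lipschitz_exp_moments(1)[OF f]])
      show "exp (l * ?m + l\<^sup>2 * (\<integral>x. ?V x \<partial>?N) / 2) \<le> exp (l * ?m + l\<^sup>2 * v / 2)"
        using mean(1) by (simp add: mult_left_mono)
    qed (use l in simp)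
    then have "(\<integral>x. exp (l * f x) * exp (- (l * ?m + l\<^sup>2 * v / 2)) \<partial>?N) \<le> 1"
      by (simp add: exp_minus field_simps)
    then show "(\<integral>x. exp (l * (f x - ?m) - l\<^sup>2 * v / 2) \<partial>?N) \<le> 1"
      by (simp add: algebra_simps flip: exp_add)
  qed
  moreover have "I.prob {x \<in> space ?N. s < ?m - f x} \<le> exp (- t) + I.prob {x \<in> space ?N. w < ?V x}"
  proof (rule I.self_normalized_tail[OF _ bd(2) _ w(1) s w(2)])
    show "bounded_rv ?N (\<lambda>x. ?m - f x)"
      by (intro bounded_rv_diff bd bounded_rv_const)
    fix l :: real assume l: "0 < l"
    have "(\<integral>x. exp (- (l * f x + l\<^sup>2 * ?V x / 2)) * exp (l * ?m) \<partial>?N) =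
        (\<integral>x. exp (- (l * f x + l\<^sup>2 * ?V x / 2)) \<partial>?N) * exp (l * ?m)"
      by simp
    also have "\<dots> \<le> exp (- (l * ?m)) * exp (l * ?m)"
      using hamming_lipschitz_exp_moments(2)[OF f, of l] l by (intro mult_right_mono) auto
    also have "\<dots> = 1"
      by (simp flip: exp_add)
    finally have "(\<integral>x. exp (- (l * f x + l\<^sup>2 * ?V x / 2)) * exp (l * ?m) \<partial>?N) \<le> 1" .
    then show "(\<integral>x. exp (l * (?m - f x) - l\<^sup>2 * ?V x / 2) \<partial>?N) \<le> 1"
      by (simp add: algebra_simps flip: exp_add)
  qed
  moreover have "I.prob {x \<in> space ?N. s < \<bar>f x - ?m\<bar>}
      \<le> I.prob ({x \<in> space ?N. s < f x - ?m} \<union> {x \<in> space ?N. s < ?m - f x})"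
    by (intro I.finite_measure_mono) auto
  moreover have "\<dots> \<le> I.prob {x \<in> space ?N. s < f x - ?m} + I.prob {x \<in> space ?N. s < ?m - f x}"
    by (intro measure_Un_le) auto
  ultimately show ?thesis by simp
qed

end

section \<open>Isolated points and local separation\<close>

text \<open>Sets failing \<open>P\<close> count as 0 instead of being left out. The maximum then
  runs over the fixed family \<open>Pow I\<close>, which makes it measurable in a parameter of
  \<open>P\<close>.\<close>

definition max_card :: "'i set \<Rightarrow> ('i set \<Rightarrow> bool) \<Rightarrow> nat" where
  "max_card I P = Max ((\<lambda>J. if P J then card J else 0) ` Pow I)"

lemma card_le_max_card: "finite I \<Longrightarrow> J \<subseteq> I \<Longrightarrow> P J \<Longrightarrow> card J \<le> max_card I P"
  unfolding max_card_def by (intro Max_ge) (auto intro!: image_eqI[of _ _ J])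

lemma max_card_attained:
  assumes "finite I" "P {}"
  obtains J where "J \<subseteq> I" "P J" "card J = max_card I P"
proof -
  have "max_card I P \<in> (\<lambda>J. if P J then card J else 0) ` Pow I"
    unfolding max_card_def using assms(1) by (intro Max_in) auto
  then obtain J where J: "J \<subseteq> I" "max_card I P = (if P J then card J else 0)" by auto
  show thesis
    using that[of J] that[of "{}"] J assms(2) by (cases "P J") auto
qed

lemma max_card_le: "finite I \<Longrightarrow> (\<And>J. J \<subseteq> I \<Longrightarrow> P J \<Longrightarrow> card J \<le> m) \<Longrightarrow> max_card I P \<le> m"
  unfolding max_card_def by (intro Max.boundedI) auto

lemma max_card_le_card: "finite I \<Longrightarrow> max_card I P \<le> card I"
  by (rule max_card_le) (auto intro: card_mono)

lemma borel_measurable_max_card: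
  assumes "finite I" "\<And>J. J \<subseteq> I \<Longrightarrow> Measurable.pred N (\<lambda>y. P y J)"
  shows "(\<lambda>y. real (max_card I (P y))) \<in> borel_measurable N"
proof -
  have "real (max_card I (P y)) = Max ((\<lambda>J. if P y J then real (card J) else 0) ` Pow I)" for y
    unfolding max_card_def using assms(1)
    by (subst mono_Max_commute[where f = real]) (auto simp: mono_def image_image intro!: arg_cong[where f = Max] image_cong)
  moreover have "(\<lambda>y. Max ((\<lambda>J. if P y J then real (card J) else 0) ` Pow I)) \<in> borel_measurable N"
  proof (rule borel_measurable_Max)
    fix J assume "J \<in> Pow I"
    then have [measurable]: "Measurable.pred N (\<lambda>y. P y J)" using assms(2) by auto
    show "(\<lambda>y. if P y J then real (card J) else 0) \<in> borel_measurable N" by measurable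
  qed (use assms(1) in auto)
  ultimately show ?thesis by simp
qed

lemma bounded_rv_max_card:
  assumes "finite I" "\<And>J. J \<subseteq> I \<Longrightarrow> Measurable.pred N (\<lambda>y. P y J)"
  shows "bounded_rv N (\<lambda>y. real (max_card I (P y)))"
  using borel_measurable_max_card[OF assms] max_card_le_card[OF assms(1)]
  by (intro bounded_rvI[where B = "real (card I)"]) auto

lemma bounded_rv_of_bool: "Measurable.pred N P \<Longrightarrow> bounded_rv N (\<lambda>x. of_bool (P x))"
  by (rule bounded_rvI[where B = 1]) (auto simp: of_bool_def)

context prob_space
begin

text \<open>Fubini for null sets, with coordinate \<open>j\<close> drawn after all the
  others.\<close>

lemma AE_sample_insert:
  assumes "finite I" "j \<in> I" and P: "Measurable.pred (PiM I (\<lambda>_. M)) P"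
    and ae: "AE x in PiM (I - {j}) (\<lambda>_. M). AE z in M. P (x(j := z))"
  shows "AE y in PiM I (\<lambda>_. M). P y"
proof -
  interpret S: product_prob_space "\<lambda>_. M" I by standard
  note P[measurable]
  have I: "insert j (I - {j}) = I" using assms(2) by auto
  let ?f = "indicator {y \<in> space (PiM I (\<lambda>_. M)). \<not> P y} :: _ \<Rightarrow> ennreal"
  have f: "?f \<in> borel_measurable (PiM (insert j (I - {j})) (\<lambda>_. M))" unfolding I by measurable
  have "(\<integral>\<^sup>+y. ?f y \<partial>PiM I (\<lambda>_. M)) = (\<integral>\<^sup>+x. (\<integral>\<^sup>+z. ?f (x(j := z)) \<partial>M) \<partial>PiM (I - {j}) (\<lambda>_. M))"
    using S.product_nn_integral_insert[OF _ _ f] assms(1) unfolding I by simp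
  also have "\<dots> = (\<integral>\<^sup>+x. (\<integral>\<^sup>+z. 0 \<partial>M) \<partial>PiM (I - {j}) (\<lambda>_. M))"
  proof (rule nn_integral_cong_AE, use ae in eventually_elim)
    fix x assume "AE z in M. P (x(j := z))"
    then show "(\<integral>\<^sup>+z. ?f (x(j := z)) \<partial>M) = (\<integral>\<^sup>+z. 0 \<partial>M)"
      by (intro nn_integral_cong_AE) (auto simp: indicator_def)
  qed
  finally have "emeasure (PiM I (\<lambda>_. M)) {y \<in> space (PiM I (\<lambda>_. M)). \<not> P y} = 0"
    by simp
  then show ?thesis
    by (intro AE_I[where N = "{y \<in> space (PiM I (\<lambda>_. M)). \<not> P y}"]) auto
qed

lemma integral_of_bool:
  "(\<integral>z. of_bool (P z) \<partial>M) = prob {z \<in> space M. P z}"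
proof -
  have "(\<integral>z. of_bool (P z) \<partial>M) = (\<integral>z. indicator {z \<in> space M. P z} z \<partial>M)"
    by (intro Bochner_Integration.integral_cong) (auto simp: indicator_def)
  also have "\<dots> = measure M ({z \<in> space M. P z} \<inter> space M)"
    by (rule Bochner_Integration.integral_indicator)
  finally show ?thesis by (simp add: Int_absorb2)
qed

lemma bounded_rv_measure_section:
  assumes "Measurable.pred (N \<Otimes>\<^sub>M M) (\<lambda>(y, z). P y z)"
  shows "bounded_rv N (\<lambda>y. prob {z \<in> space M. P y z})"
proof -
  have "bounded_rv (N \<Otimes>\<^sub>M M) (\<lambda>(y, z). of_bool (P y z))"
    using bounded_rv_of_bool[OF assms] by (simp add: case_prod_beta')
  then have "bounded_rv N (\<lambda>y. \<integral>z. of_bool (P y z) \<partial>M)"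
    by (rule bounded_rv_integral)
  then show ?thesis by (simp only: integral_of_bool)
qed

end

text \<open>Here \<open>R\<close> is a version of \<open>d x y <= r\<close> known only up to a null
  set of the product, which may contain the diagonal. Accordingly \<open>isolated\<close>,
  \<open>separated\<close> and \<open>first_near\<close> compare only sample points with distinct
  indices.\<close>

locale proximity_sample = prob_space M for M :: "'a measure" +
  fixes R :: "'a \<Rightarrow> 'a \<Rightarrow> bool" and I :: "nat set"
  assumes measurable_R: "Measurable.pred (M \<Otimes>\<^sub>M M) (\<lambda>(x, y). R x y)"
    and R_sym: "R x y \<Longrightarrow> R y x"
    and finite_I: "finite I"
begin

abbreviation "S \<equiv> PiM I (\<lambda>_. M)"

sublocale sample: prob_space S
  by (rule prob_space_sample)

lemma measurable_R_coords [measurable (raw)]: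
  assumes "f \<in> measurable N M" "g \<in> measurable N M"
  shows "Measurable.pred N (\<lambda>x. R (f x) (g x))"
  using measurable_compose[OF measurable_Pair[OF assms] measurable_R] by simp

definition isolated :: "(nat \<Rightarrow> 'a) \<Rightarrow> nat \<Rightarrow> bool" where
  "isolated y k \<longleftrightarrow> (\<forall>i\<in>I - {k}. \<not> R (y i) (y k))"

definition separated :: "(nat \<Rightarrow> 'a) \<Rightarrow> nat set \<Rightarrow> bool" where
  "separated y J \<longleftrightarrow> (\<forall>i\<in>J. \<forall>j\<in>J. i \<noteq> j \<longrightarrow> \<not> R (y i) (y j))"

definition loc_sep :: "(nat \<Rightarrow> 'a) \<Rightarrow> nat set \<Rightarrow> bool" where
  "loc_sep y J \<longleftrightarrow> separated y J \<and> 0 < prob {z \<in> space M. \<forall>j\<in>J. R (y j) z}"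

definition loc_sep_num :: "(nat \<Rightarrow> 'a) \<Rightarrow> nat" where
  "loc_sep_num y = max_card I (loc_sep y)"

definition isolated_count :: "(nat \<Rightarrow> 'a) \<Rightarrow> real" where
  "isolated_count y = (\<Sum>k\<in>I. of_bool (isolated y k))"

text \<open>Choosing the least neighbour charges each non-isolated \<open>k\<close> to exactly one
  \<open>j\<close>.\<close>

definition first_near :: "(nat \<Rightarrow> 'a) \<Rightarrow> nat \<Rightarrow> nat \<Rightarrow> bool" where
  "first_near y k j \<longleftrightarrow> j \<in> I \<and> j \<noteq> k \<and> R (y j) (y k) \<and> (\<forall>i\<in>I - {k}. i < j \<longrightarrow> \<not> R (y i) (y k))"

text \<open>An upper bound, depending on \<open>y\<close> alone, for the number of unmoved points
  that can become isolated because \<open>j\<close> moves away.\<close>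

definition cluster_num :: "nat \<Rightarrow> (nat \<Rightarrow> 'a) \<Rightarrow> nat" where
  "cluster_num j y = max_card I (\<lambda>K. separated y K \<and> (\<forall>k\<in>K. first_near y k j))"

lemma pred_separated: "J \<subseteq> I \<Longrightarrow> Measurable.pred S (\<lambda>y. separated y J)"
  using finite_subset[OF _ finite_I, of J] unfolding separated_def subset_eq
  by measurable

lemma pred_isolated: "k \<in> I \<Longrightarrow> Measurable.pred S (\<lambda>y. isolated y k)"
  using finite_I unfolding isolated_def by measurable

lemma pred_first_near: "k \<in> I \<Longrightarrow> Measurable.pred S (\<lambda>y. first_near y k j)"
  using finite_I unfolding first_near_def by (cases "j \<in> I") measurable

lemma bounded_rv_common:
  assumes "J \<subseteq> I"
  shows "bounded_rv S (\<lambda>y. prob {z \<in> space M. \<forall>j\<in>J. R (y j) z})"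
proof (rule bounded_rv_measure_section)
  have [measurable]: "\<And>j. j \<in> J \<Longrightarrow> j \<in> I" and "finite J" using assms finite_subset[OF _ finite_I] by auto
  then show "Measurable.pred (S \<Otimes>\<^sub>M M) (\<lambda>(y, z). \<forall>j\<in>J. R (y j) z)"
    by measurable
qed

lemma pred_loc_sep:
  assumes "J \<subseteq> I" shows "Measurable.pred S (\<lambda>y. loc_sep y J)"
proof -
  note [measurable] = pred_separated[OF assms] bounded_rv_measurable[OF bounded_rv_common[OF assms]]
  show ?thesis unfolding loc_sep_def by measurable
qed

lemma bounded_rv_loc_sep_num: "bounded_rv S (\<lambda>y. real (loc_sep_num y))"
  unfolding loc_sep_num_def by (intro bounded_rv_max_card finite_I pred_loc_sep)

lemma bounded_rv_isolated_count: "bounded_rv S isolated_count"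
  unfolding isolated_count_def by (intro bounded_rv_sum bounded_rv_of_bool pred_isolated)

lemma bounded_rv_cluster_num: "bounded_rv S (\<lambda>y. real (cluster_num j y))"
  unfolding cluster_num_def
proof (intro bounded_rv_max_card finite_I)
  fix J assume J: "J \<subseteq> I"
  then have "finite J" using finite_I finite_subset by auto
  moreover have "\<And>k. k \<in> J \<Longrightarrow> Measurable.pred S (\<lambda>y. first_near y k j)"
    using J by (intro pred_first_near) auto
  ultimately show "Measurable.pred S (\<lambda>y. separated y J \<and> (\<forall>k\<in>J. first_near y k j))"
    using pred_separated[OF J] by measurable
qed

lemma loc_sep_empty: "loc_sep y {}"
  by (simp add: loc_sep_def separated_def prob_space)

lemma loc_sep_cong:
  assumes "\<And>j. j \<in> J \<Longrightarrow> x j = y j" shows "loc_sep x J \<longleftrightarrow> loc_sep y J"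
proof -
  have "{z \<in> space M. \<forall>j\<in>J. R (x j) z} = {z \<in> space M. \<forall>j\<in>J. R (y j) z}"
    using assms by auto
  moreover have "separated x J \<longleftrightarrow> separated y J"
    using assms by (auto simp: separated_def)
  ultimately show ?thesis by (simp add: loc_sep_def)
qed

text \<open>Dropping points only enlarges the set of common neighbours. This heredity is what makes
  \<open>loc_sep_num\<close> self-bounding.\<close>

lemma loc_sep_subset:
  assumes "y \<in> space S" "K \<subseteq> I" "loc_sep y K" "J \<subseteq> K" shows "loc_sep y J"
proof -
  have yM: "y j \<in> space M" if "j \<in> I" for j
    using assms(1) that by (auto simp: space_PiM)
  have J: "finite J" "J \<subseteq> I"
    using assms finite_subset[OF _ finite_I] by auto
  have "prob {z \<in> space M. \<forall>j\<in>K. R (y j) z} \<le> prob {z \<in> space M. \<forall>j\<in>J. R (y j) z}"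
  proof (rule finite_measure_mono)
    have "Measurable.pred M (\<lambda>z. \<forall>j\<in>J. R (y j) z)"
      using J yM by (intro pred_intros_finite measurable_R_coords) auto
    then show "{z \<in> space M. \<forall>j\<in>J. R (y j) z} \<in> sets M" by measurable
  qed (use assms(4) in auto)
  moreover have "separated y J"
    using assms(3,4) unfolding loc_sep_def separated_def by blast
  ultimately show ?thesis
    using assms(3) by (auto simp: loc_sep_def)
qed

text \<open>The point \<open>y j\<close> is drawn independently of the points in \<open>K\<close>;
  if their common neighbours form a null set, it almost surely avoids that set.\<close>

lemma AE_common_pos:
  assumes "K \<subseteq> I" "j \<in> I - K"
  shows "AE y in S. (\<forall>k\<in>K. R (y k) (y j)) \<longrightarrow> 0 < prob {z \<in> space M. \<forall>k\<in>K. R (y k) z}"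
proof (rule AE_sample_insert[OF finite_I, of j])
  have K: "finite K" "\<And>k. k \<in> K \<Longrightarrow> k \<in> I" using assms finite_subset[OF _ finite_I] by auto
  have "Measurable.pred S (\<lambda>y. \<forall>k\<in>K. R (y k) (y j))"
    using K assms by (intro pred_intros_finite measurable_R_coords measurable_component_singleton) auto
  then show "Measurable.pred S (\<lambda>y. (\<forall>k\<in>K. R (y k) (y j)) \<longrightarrow> 0 < prob {z \<in> space M. \<forall>k\<in>K. R (y k) z})"
    using bounded_rv_measurable[OF bounded_rv_common[OF assms(1)]] by measurable
  show "AE x in PiM (I - {j}) (\<lambda>_. M). AE z in M. (\<forall>k\<in>K. R ((x(j := z)) k) ((x(j := z)) j)) \<longrightarrow>
      0 < prob {w \<in> space M. \<forall>k\<in>K. R ((x(j := z)) k) w}"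
  proof (rule AE_I2)
    fix x assume x: "x \<in> space (PiM (I - {j}) (\<lambda>_. M))"
    then have xM: "x k \<in> space M" if "k \<in> K" for k
      using that assms by (auto simp: space_PiM PiE_def)
    have upd: "(x(j := z)) k = x k" if "k \<in> K" for k z
      using that assms by auto
    have meas: "{w \<in> space M. \<forall>k\<in>K. R (x k) w} \<in> sets M"
    proof -
      have "Measurable.pred M (\<lambda>z. \<forall>j\<in>K. R (x j) z)"
        using K xM by (intro pred_intros_finite measurable_R_coords) auto
      then show ?thesis by measurable
    qed
    show "AE z in M. (\<forall>k\<in>K. R ((x(j := z)) k) ((x(j := z)) j)) \<longrightarrow>
      0 < prob {w \<in> space M. \<forall>k\<in>K. R ((x(j := z)) k) w}"
    proof (cases "0 < prob {w \<in> space M. \<forall>k\<in>K. R (x k) w}")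
      case True
      then show ?thesis using upd by (simp cong: ball_cong)
    next
      case False
      then have "{w \<in> space M. \<forall>k\<in>K. R (x k) w} \<in> null_sets M"
        using meas by (simp add: null_sets_def emeasure_eq_measure zero_less_measure_iff)
      then have "AE z in M. z \<notin> {w \<in> space M. \<forall>k\<in>K. R (x k) w}"
        by (rule AE_not_in)
      then show ?thesis
        using AE_space by eventually_elim (use upd in auto)
    qed
  qed
qed (use assms in auto)

text \<open>The bridge from geometry to \<open>loc_sep_num\<close> for both statistics: a sample
  point serves as common neighbour of any separated sample points around it.\<close>

lemma AE_neighbourhood_loc_sep:
  "AE y in S. \<forall>j\<in>I. \<forall>K. K \<subseteq> I - {j} \<longrightarrow> separated y K \<longrightarrow> (\<forall>k\<in>K. R (y k) (y j)) \<longrightarrow> loc_sep y K"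
proof -
  have "AE y in S. \<forall>j\<in>I. \<forall>K\<in>Pow (I - {j}). (\<forall>k\<in>K. R (y k) (y j)) \<longrightarrow> 0 < prob {z \<in> space M. \<forall>k\<in>K. R (y k) z}"
    using finite_I by (intro AE_finite_allI AE_common_pos) auto
  then show ?thesis
    by eventually_elim (auto simp: loc_sep_def)
qed

lemma first_near_unique:
  assumes "first_near y k j" "first_near y k j'" shows "j = j'"
  using assms unfolding first_near_def by (metis DiffI linorder_neqE_nat singletonD)

lemma first_near_exists:
  assumes "\<not> isolated y k"
  obtains j where "first_near y k j"
proof -
  have ex: "\<exists>i. i \<in> I - {k} \<and> R (y i) (y k)"
    using assms unfolding isolated_def by auto
  define j where "j = (LEAST i. i \<in> I - {k} \<and> R (y i) (y k))"
  have "j \<in> I - {k} \<and> R (y j) (y k)"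
    unfolding j_def using ex by (rule LeastI_ex)
  moreover have "\<not> (i \<in> I - {k} \<and> R (y i) (y k))" if "i < j" for i
    using that unfolding j_def by (rule not_less_Least)
  ultimately show thesis
    by (intro that[of j]) (auto simp: first_near_def)
qed

lemma isolated_count_eq_card: "isolated_count y = real (card {k \<in> I. isolated y k})"
  unfolding isolated_count_def using finite_I
  by (simp add: of_bool_def sum.If_cases Int_def conj_commute)

lemma sum_differing: "(\<Sum>j\<in>I. f j * of_bool (x j \<noteq> y j)) = (\<Sum>j | j \<in> I \<and> x j \<noteq> y j. f j :: real)"
  using finite_I by (simp add: of_bool_def if_distrib sum.If_cases Int_def cong: if_cong)

text \<open>A point isolated in \<open>x\<close> is isolated in \<open>y\<close>, or has moved, or
  is unmoved and has a neighbour in \<open>y\<close>. In the last case its first neighbour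
  \<open>j\<close> must have moved, since otherwise the two would still be close in
  \<open>x\<close>. The unmoved points charged to one \<open>j\<close> are separated in
  \<open>y\<close>, because they are isolated in \<open>x\<close>.\<close>

lemma isolated_count_le:
  "isolated_count x \<le> isolated_count y + (\<Sum>j\<in>I. (1 + real (cluster_num j y)) * of_bool (x j \<noteq> y j))"
proof -
  define A B D where "A = {k \<in> I. isolated x k}" and "B = {k \<in> I. isolated y k}"
    and "D = {j. j \<in> I \<and> x j \<noteq> y j}"
  define K where "K j = {k \<in> A - D. first_near y k j}" for j
  have fin: "finite A" "finite B" "finite D"
    using finite_I by (auto simp: A_def B_def D_def)
  have "A \<subseteq> B \<union> D \<union> (\<Union>j\<in>D. K j)"
  proof (rule subsetI, rule ccontr)
    fix k assume k: "k \<in> A" and contra: "k \<notin> B \<union> D \<union> (\<Union>j\<in>D. K j)"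
    then have "\<not> isolated y k" by (auto simp: A_def B_def)
    then obtain j where j: "first_near y k j" by (rule first_near_exists)
    have "j \<notin> D" using contra k j by (auto simp: K_def)
    then have "R (x j) (x k)" "j \<in> I - {k}"
      using j contra k by (auto simp: first_near_def D_def A_def)
    then show False using k by (auto simp: A_def isolated_def)
  qed
  then have "card A \<le> card (B \<union> D \<union> (\<Union>j\<in>D. K j))"
    using fin by (intro card_mono) (auto simp: K_def)
  also have "\<dots> \<le> card B + card D + card (\<Union>j\<in>D. K j)"
    by (meson add_le_mono1 card_Un_le order_trans)
  also have "card (\<Union>j\<in>D. K j) \<le> (\<Sum>j\<in>D. card (K j))"
    by (rule card_UN_le[OF fin(3)])
  also have "(\<Sum>j\<in>D. card (K j)) \<le> (\<Sum>j\<in>D. cluster_num j y)"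
  proof (rule sum_mono)
    fix j assume "j \<in> D"
    have "separated y (K j)"
      unfolding separated_def
    proof (intro ballI impI)
      fix k l assume "k \<in> K j" "l \<in> K j" "k \<noteq> l"
      then have "x k = y k" "x l = y l" "isolated x l" "k \<in> I - {l}"
        by (auto simp: K_def A_def D_def)
      then show "\<not> R (y k) (y l)" by (metis isolated_def)
    qed
    then show "card (K j) \<le> cluster_num j y"
      unfolding cluster_num_def using finite_I
      by (intro card_le_max_card) (auto simp: K_def A_def)
  qed
  finally have "real (card A) \<le> real (card B + card D + (\<Sum>j\<in>D. cluster_num j y))"
    by (simp only: of_nat_le_iff)
  then show ?thesis
    unfolding isolated_count_eq_card sum_differing A_def[symmetric] B_def[symmetric] D_def[symmetric]
    by (simp add: sum.distrib)
qed

text \<open>Optimal clusters of different \<open>j\<close> are disjoint, as first neighbours are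
  unique.\<close>

lemma sum_cluster_num_le: "(\<Sum>j\<in>I. cluster_num j y) \<le> card I"
proof -
  have "\<exists>K. K \<subseteq> I \<and> (\<forall>k\<in>K. first_near y k j) \<and> card K = cluster_num j y" for j
    unfolding cluster_num_def
    by (rule max_card_attained[OF finite_I, of "\<lambda>K. separated y K \<and> (\<forall>k\<in>K. first_near y k j)"])
       (auto simp: separated_def)
  then obtain K where K: "\<And>j. K j \<subseteq> I" "\<And>j k. k \<in> K j \<Longrightarrow> first_near y k j" "\<And>j. card (K j) = cluster_num j y"
    by metis
  have "(\<Sum>j\<in>I. card (K j)) = card (\<Union>j\<in>I. K j)"
    using finite_I finite_subset[OF K(1)] first_near_unique[OF K(2) K(2)]
    by (intro card_UN_disjoint[symmetric]) blast+
  also have "\<dots> \<le> card I"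
    using finite_I K(1) by (intro card_mono) auto
  finally show ?thesis by (simp add: K(3))
qed

lemma AE_cluster_num_le: "AE y in S. \<forall>j\<in>I. cluster_num j y \<le> loc_sep_num y"
  using AE_neighbourhood_loc_sep
proof eventually_elim
  case (elim y)
  show ?case
  proof
    fix j assume j: "j \<in> I"
    show "cluster_num j y \<le> loc_sep_num y"
      unfolding cluster_num_def
    proof (rule max_card_le[OF finite_I])
      fix K assume K: "K \<subseteq> I" "separated y K \<and> (\<forall>k\<in>K. first_near y k j)"
      then have "K \<subseteq> I - {j}" "\<forall>k\<in>K. R (y k) (y j)"
        using R_sym by (auto simp: first_near_def)
      then have "loc_sep y K" using elim j K by auto
      then show "card K \<le> loc_sep_num y"
        unfolding loc_sep_num_def by (intro card_le_max_card finite_I K)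
    qed
  qed
qed

text \<open>With \<open>k\<close> the cluster number, \<open>(1 + k)^2 <= 2 + 2 * k^2\<close>. One
  factor \<open>k\<close> is bounded by \<open>loc_sep_num\<close>, and the other is summed over the
  disjoint clusters.\<close>

lemma AE_sum_cluster_weights_le:
  "AE y in S. (\<Sum>j\<in>I. (1 + real (cluster_num j y))\<^sup>2) \<le> 2 * (1 + real (loc_sep_num y)) * real (card I)"
  using AE_cluster_num_le
proof eventually_elim
  case (elim y)
  have "(\<Sum>j\<in>I. (1 + real (cluster_num j y))\<^sup>2) \<le> (\<Sum>j\<in>I. 2 + 2 * (real (loc_sep_num y) * real (cluster_num j y)))"
  proof (rule sum_mono)
    fix j assume "j \<in> I"
    then have "real (cluster_num j y) * real (cluster_num j y) \<le> real (loc_sep_num y) * real (cluster_num j y)"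
      using elim by (intro mult_right_mono) auto
    then show "(1 + real (cluster_num j y))\<^sup>2 \<le> 2 + 2 * (real (loc_sep_num y) * real (cluster_num j y))"
      using sum_squares_bound[of 1 "real (cluster_num j y)"] by (simp add: power2_eq_square algebra_simps)
  qed
  also have "\<dots> = 2 * card I + 2 * (real (loc_sep_num y) * real (\<Sum>j\<in>I. cluster_num j y))"
    by (simp add: sum.distrib sum_distrib_left)
  also have "\<dots> \<le> 2 * card I + 2 * (real (loc_sep_num y) * real (card I))"
    using sum_cluster_num_le[of y] by (intro add_left_mono mult_left_mono) (auto simp only: of_nat_le_iff)
  finally show ?case by (simp add: algebra_simps)
qed

lemma hamming_lipschitz_isolated:
  "hamming_lipschitz I (\<lambda>y. isolated_count y / real (card I)) (\<lambda>j y. (1 + real (cluster_num j y)) / real (card I))"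
  unfolding hamming_lipschitz_def
proof (intro conjI ballI finite_I)
  show "bounded_rv S (\<lambda>y. isolated_count y / real (card I))"
    by (intro bounded_rv_divide bounded_rv_isolated_count)
  show "bounded_rv S (\<lambda>y. (1 + real (cluster_num j y)) / real (card I))" for j
    by (intro bounded_rv_divide bounded_rv_add bounded_rv_const bounded_rv_cluster_num)
  fix x y
  show "isolated_count x / real (card I) \<le> isolated_count y / real (card I) +
      (\<Sum>j\<in>I. (1 + real (cluster_num j y)) / real (card I) * of_bool (x j \<noteq> y j))"
    using divide_right_mono[OF isolated_count_le[of x y], of "real (card I)"]
    by (simp only: add_divide_distrib[of "isolated_count y"] sum_divide_distrib times_divide_eq_left
        of_nat_0_le_iff simp_thms)
qed auto

text \<open>The least code of an optimal index set, so that the selection is measurable.\<close>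

definition witness :: "(nat \<Rightarrow> 'a) \<Rightarrow> nat set" where
  "witness y = set_decode (LEAST m. set_decode m \<subseteq> I \<and> loc_sep y (set_decode m) \<and> card (set_decode m) = loc_sep_num y)"

lemma witness_props: "witness y \<subseteq> I" "loc_sep y (witness y)" "card (witness y) = loc_sep_num y"
proof -
  obtain J where J: "J \<subseteq> I" "loc_sep y J" "card J = loc_sep_num y"
    unfolding loc_sep_num_def by (rule max_card_attained[OF finite_I, of "loc_sep y"]) (rule loc_sep_empty)
  then have "finite J" using finite_I finite_subset by auto
  then have "\<exists>m. set_decode m \<subseteq> I \<and> loc_sep y (set_decode m) \<and> card (set_decode m) = loc_sep_num y"
    using J by (intro exI[of _ "set_encode J"]) simp
  from LeastI_ex[OF this] show "witness y \<subseteq> I" "loc_sep y (witness y)" "card (witness y) = loc_sep_num y"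
    unfolding witness_def by auto
qed

lemma pred_witness: "Measurable.pred S (\<lambda>y. j \<in> witness y)"
proof -
  have "(\<lambda>y. LEAST m. set_decode m \<subseteq> I \<and> loc_sep y (set_decode m) \<and> card (set_decode m) = loc_sep_num y)
      \<in> measurable S (count_space UNIV)"
  proof (rule measurable_Least)
    fix m
    have [measurable]: "(\<lambda>y. real (loc_sep_num y)) \<in> borel_measurable S"
      by (rule bounded_rv_measurable[OF bounded_rv_loc_sep_num])
    show "Measurable.pred S (\<lambda>y. set_decode m \<subseteq> I \<and> loc_sep y (set_decode m) \<and> card (set_decode m) = loc_sep_num y)"
    proof (cases "set_decode m \<subseteq> I")
      case True
      note [measurable] = pred_loc_sep[OF True]
      have "Measurable.pred S (\<lambda>y. loc_sep y (set_decode m) \<and> real (card (set_decode m)) = real (loc_sep_num y))"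
        by measurable
      then show ?thesis using True by simp
    qed simp
  qed
  then show ?thesis
    unfolding witness_def by (rule measurable_compose) simp
qed

text \<open>Removing the moved points from an optimal set of \<open>y\<close> leaves a locally
  separated set of \<open>x\<close>. The loss is counted on a set chosen from \<open>y\<close>,
  which fixes the direction of the inequality and hence the minus sign.\<close>

lemma hamming_lipschitz_loc_sep_num:
  "hamming_lipschitz I (\<lambda>y. - real (loc_sep_num y)) (\<lambda>j y. of_bool (j \<in> witness y))"
  unfolding hamming_lipschitz_def
proof (intro conjI ballI finite_I)
  show "bounded_rv S (\<lambda>y. - real (loc_sep_num y))"
    by (intro bounded_rv_uminus bounded_rv_loc_sep_num)
  show "bounded_rv S (\<lambda>y. of_bool (j \<in> witness y))" for j
    by (intro bounded_rv_of_bool pred_witness)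
  fix x y assume y: "y \<in> space S"
  let ?D = "{j. j \<in> I \<and> x j \<noteq> y j}" and ?J = "witness y"
  have fin: "finite ?J" using finite_subset[OF witness_props(1) finite_I] .
  have "loc_sep y (?J - ?D)"
    using y witness_props(1,2) by (rule loc_sep_subset) auto
  moreover have "loc_sep x (?J - ?D) \<longleftrightarrow> loc_sep y (?J - ?D)"
    using witness_props(1)[of y] by (intro loc_sep_cong) auto
  ultimately have "card (?J - ?D) \<le> loc_sep_num x"
    unfolding loc_sep_num_def using witness_props(1)[of y] by (intro card_le_max_card finite_I) auto
  moreover have "card ?J \<le> card (?J - ?D) + card (?J \<inter> ?D)"
    using card_Un_le[of "?J - ?D" "?J \<inter> ?D"] by (simp add: Un_Diff_Int)
  ultimately have "loc_sep_num y \<le> loc_sep_num x + card (?J \<inter> ?D)"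
    using witness_props(3)[of y] by simp
  moreover have "real (card (?J \<inter> ?D)) = (\<Sum>j\<in>I. of_bool (j \<in> ?J) * of_bool (x j \<noteq> y j))"
  proof -
    have "?J \<inter> ?D = {j \<in> ?D. j \<in> ?J}" by auto
    then show ?thesis
      unfolding sum_differing using finite_I by (simp add: of_bool_def sum.If_cases Int_def)
  qed
  ultimately show "- real (loc_sep_num x) \<le> - real (loc_sep_num y) + (\<Sum>j\<in>I. of_bool (j \<in> ?J) * of_bool (x j \<noteq> y j))"
    by linarith
qed auto

text \<open>The weights are indicators of an optimal set, so their squares sum to
  \<open>loc_sep_num\<close> itself. At \<open>l = 1\<close> the lower estimate for
  \<open>- loc_sep_num\<close> therefore has exponent \<open>h - h / 2\<close>.\<close>

lemma loc_sep_num_exp_moment: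
  "(\<integral>y. exp (real (loc_sep_num y) / 2) \<partial>S) \<le> exp (\<integral>y. real (loc_sep_num y) \<partial>S)"
proof -
  have "(\<Sum>j\<in>I. (of_bool (j \<in> witness y))\<^sup>2) = real (loc_sep_num y)" for y
  proof -
    have "(\<Sum>j\<in>I. (of_bool (j \<in> witness y))\<^sup>2) = (\<Sum>j\<in>I. if j \<in> witness y then 1 else 0 :: real)"
      by (intro sum.cong) auto
    then show ?thesis
      using witness_props(1)[of y] finite_I by (simp add: sum.If_cases Int_absorb1 witness_props(3))
  qed
  then show ?thesis
    using hamming_lipschitz_exp_moments(2)[OF hamming_lipschitz_loc_sep_num, of 1] by simp
qed

lemma loc_sep_num_tail:
  "sample.prob {y \<in> space S. 2 * (\<integral>y. real (loc_sep_num y) \<partial>S) + 2 * t < real (loc_sep_num y)} \<le> exp (- t)"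
proof -
  let ?m = "\<integral>y. real (loc_sep_num y) \<partial>S"
  let ?A = "{y \<in> space S. 2 * ?m + 2 * t < real (loc_sep_num y)}"
  note bd = bounded_rv_exp[OF bounded_rv_divide[OF bounded_rv_loc_sep_num, of 2]]
  note [measurable] = bounded_rv_measurable[OF bounded_rv_loc_sep_num]
  have "sample.prob ?A = (\<integral>y. indicator ?A y \<partial>S)" by simp
  also have "\<dots> \<le> (\<integral>y. exp (real (loc_sep_num y) / 2) * exp (- (?m + t)) \<partial>S)"
  proof (intro integral_mono sample.integrable_bounded_rv bounded_rv_mult bounded_rv_const bd)
    show "bounded_rv S (indicator ?A)"
      by (intro bounded_rvI[where B = 1]) (auto simp: indicator_def)
    fix y
    show "indicator ?A y \<le> exp (real (loc_sep_num y) / 2) * exp (- (?m + t))"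
      by (auto simp: indicator_def simp flip: exp_add)
  qed
  also have "\<dots> \<le> exp ?m * exp (- (?m + t))"
    using loc_sep_num_exp_moment by simp
  also have "\<dots> = exp (- t)" by (simp flip: exp_add)
  finally show ?thesis .
qed

end

section \<open>Uncovered mass\<close>

text \<open>All that is used of the cyclic order is that \<open>c\<close> permutes \<open>I\<close>
  in a single cycle; arithmetic modulo the sample size is confined to the instance.\<close>

locale cyclic_proximity_sample = proximity_sample +
  fixes c :: "nat \<Rightarrow> nat"
  assumes c_bij: "bij_betw c I I"
    and c_orbit: "j \<in> I \<Longrightarrow> bij_betw (\<lambda>l. (c ^^ l) j) {..<card I} I"
begin

text \<open>Equivalently, \<open>j\<close> is the first sample point near \<open>z\<close> met when
  walking backwards along the cycle from \<open>(c ^^ l) j\<close>.\<close>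

definition tie :: "(nat \<Rightarrow> 'a) \<Rightarrow> nat \<Rightarrow> nat \<Rightarrow> 'a \<Rightarrow> bool" where
  "tie y j l z \<longleftrightarrow> R (y j) z \<and> (\<forall>i\<in>{1..l}. \<not> R (y ((c ^^ i) j)) z)"

definition cell :: "(nat \<Rightarrow> 'a) \<Rightarrow> nat \<Rightarrow> nat \<Rightarrow> real" where
  "cell y j l = prob {z \<in> space M. tie y j l z}"

text \<open>Averaging \<open>cell y j l\<close> over \<open>l\<close> averages, over all starting points of the cyclic order, the
  mass for which \<open>j\<close> is the first sample point nearby.\<close>

definition weight :: "nat \<Rightarrow> (nat \<Rightarrow> 'a) \<Rightarrow> real" where
  "weight j y = (\<Sum>l<card I. cell y j l) / real (card I)"

definition uncovered_mass :: "(nat \<Rightarrow> 'a) \<Rightarrow> real" where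
  "uncovered_mass y = prob {z \<in> space M. \<forall>k\<in>I. \<not> R (y k) z}"

definition ties :: "(nat \<Rightarrow> 'a) \<Rightarrow> 'a \<Rightarrow> (nat \<times> nat) set" where
  "ties y z = {(j, l). j \<in> I \<and> l < card I \<and> tie y j l z}"

lemma funpow_c_in: "j \<in> I \<Longrightarrow> (c ^^ l) j \<in> I"
  using bij_betw_funpow[OF c_bij, of l] by (auto simp: bij_betw_def)

lemma funpow_c_inj: "j \<in> I \<Longrightarrow> k \<in> I \<Longrightarrow> (c ^^ l) j = (c ^^ l) k \<Longrightarrow> j = k"
  using bij_betw_funpow[OF c_bij, of l] by (auto simp: bij_betw_def inj_on_def)

lemma funpow_c_eq_iff: "j \<in> I \<Longrightarrow> l < card I \<Longrightarrow> m < card I \<Longrightarrow> (c ^^ l) j = (c ^^ m) j \<longleftrightarrow> l = m"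
  using c_orbit[of j] by (auto simp: bij_betw_def inj_on_def)

lemma finite_ties: "finite (ties y z)"
  by (rule finite_subset[of _ "I \<times> {..<card I}"]) (auto simp: ties_def finite_I)

text \<open>The pair \<open>(j, l)\<close> is determined by its starting point
  \<open>(c ^^ l) j\<close>: if two pairs share it, the one with the longer walk has passed the end
  of the other, which is near \<open>z\<close>.\<close>

lemma card_ties_le: "card (ties y z) \<le> card I"
proof (rule card_inj_on_le[OF _ _ finite_I])
  have *: False if "(j, l) \<in> ties y z" "(j', l') \<in> ties y z" "(c ^^ l) j = (c ^^ l') j'" "l < l'" for j l j' l'
  proof -
    have "(c ^^ l) j = (c ^^ l) ((c ^^ (l' - l)) j')"
      using that by (simp flip: funpow_add comp_apply[of "c ^^ l" "c ^^ (l' - l)"])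
    then have "j = (c ^^ (l' - l)) j'"
      using that funpow_c_in funpow_c_inj by (auto simp: ties_def)
    moreover have "\<not> R (y ((c ^^ (l' - l)) j')) z"
      using that by (auto simp: ties_def tie_def)
    ultimately show False
      using that by (auto simp: ties_def tie_def)
  qed
  show "inj_on (\<lambda>(j, l). (c ^^ l) j) (ties y z)"
  proof (rule inj_onI, safe)
    fix j l j' l' assume t: "(j, l) \<in> ties y z" "(j', l') \<in> ties y z" "(c ^^ l) j = (c ^^ l') j'"
    have "l = l'"
      using *[OF t] *[OF t(2) t(1) t(3)[symmetric]] by (meson linorder_neqE_nat)
    then show "j = j'" "l = l'"
      using t funpow_c_inj by (auto simp: ties_def)
  qed
qed (auto simp: ties_def funpow_c_in)

text \<open>If \<open>z\<close> is covered, the backward walk from every starting point meets a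
  nearby sample point; the least number of steps gives a tie.\<close>

lemma card_ties_ge:
  assumes "k \<in> I" "R (y k) z" shows "card I \<le> card (ties y z)"
proof (rule surj_card_le[OF finite_ties, of _ "\<lambda>(j, l). (c ^^ l) j"], rule subsetI)
  fix s assume s: "s \<in> I"
  define P where "P l \<longleftrightarrow> l < card I \<and> (\<exists>j\<in>I. R (y j) z \<and> (c ^^ l) j = s)" for l
  have "s \<in> (\<lambda>l. (c ^^ l) k) ` {..<card I}"
    using c_orbit[OF assms(1)] s by (simp add: bij_betw_def)
  then have "\<exists>l. P l"
    using assms unfolding P_def by auto
  then have P: "P (LEAST l. P l)"
    by (rule LeastI_ex)
  have minimal: "\<not> P m" if "m < (LEAST l. P l)" for m
    using that by (rule not_less_Least)
  define l where "l = (LEAST l. P l)"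
  obtain j where j: "l < card I" "j \<in> I" "R (y j) z" "(c ^^ l) j = s"
    using P[folded l_def] unfolding P_def by auto
  have "\<not> R (y ((c ^^ i) j)) z" if "i \<in> {1..l}" for i
  proof
    assume "R (y ((c ^^ i) j)) z"
    moreover have "(c ^^ (l - i)) ((c ^^ i) j) = s"
      using that j by (simp flip: funpow_add comp_apply[of "c ^^ (l - i)" "c ^^ i"])
    ultimately have "P (l - i)"
      using j funpow_c_in unfolding P_def by auto
    then show False using minimal[of "l - i"] that unfolding l_def by auto
  qed
  then show "s \<in> (\<lambda>(j, l). (c ^^ l) j) ` ties y z"
    using j by (intro image_eqI[of _ _ "(j, l)"]) (auto simp: ties_def tie_def)
qed

lemma card_ties: "real (card (ties y z)) = (\<Sum>j\<in>I. \<Sum>l<card I. of_bool (tie y j l z))"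
proof -
  have "ties y z = {p \<in> I \<times> {..<card I}. tie y (fst p) (snd p) z}"
    by (auto simp: ties_def)
  then have "real (card (ties y z)) = (\<Sum>p\<in>I \<times> {..<card I}. of_bool (tie y (fst p) (snd p) z))"
    using finite_I by (simp add: of_bool_def sum.If_cases Int_def conj_commute)
  then show ?thesis
    by (simp only: sum.cartesian_product split_def)
qed

lemma space_sample_coord: "y \<in> space S \<Longrightarrow> k \<in> I \<Longrightarrow> y k \<in> space M"
  by (auto simp: space_PiM)

lemma pred_tie:
  assumes "y \<in> space S" "j \<in> I" shows "Measurable.pred M (tie y j l)"
  unfolding tie_def using assms
  by (intro pred_intros_logic pred_intros_finite measurable_R_coords measurable_const)
     (auto intro: space_sample_coord funpow_c_in)

lemma bounded_rv_cell:
  assumes "j \<in> I" shows "bounded_rv S (\<lambda>y. cell y j l)"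
  unfolding cell_def
proof (rule bounded_rv_measure_section)
  have [measurable]: "\<And>i. (c ^^ i) j \<in> I" using assms funpow_c_in by auto
  show "Measurable.pred (S \<Otimes>\<^sub>M M) (\<lambda>(y, z). tie y j l z)"
    unfolding tie_def using assms by measurable
qed

lemma bounded_rv_weight: "j \<in> I \<Longrightarrow> bounded_rv S (weight j)"
  unfolding weight_def by (intro bounded_rv_divide bounded_rv_sum bounded_rv_cell)

lemma bounded_rv_uncovered_mass: "bounded_rv S uncovered_mass"
  unfolding uncovered_mass_def
  by (rule bounded_rv_measure_section) (use finite_I in measurable)

lemma cell_nonneg: "0 \<le> cell y j l"
  by (simp add: cell_def)

lemma weight_nonneg: "0 \<le> weight j y"
  by (simp add: weight_def cell_nonneg sum_nonneg)

lemma bounded_rv_ties: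
  assumes "y \<in> space S"
  shows "bounded_rv M (\<lambda>z. (\<Sum>j\<in>I. a j * (\<Sum>l<card I. of_bool (tie y j l z))) / real (card I))"
  by (intro bounded_rv_divide bounded_rv_sum bounded_rv_mult bounded_rv_const bounded_rv_of_bool pred_tie assms)

text \<open>Turns sums of weights into pointwise counts of ties. Coefficients 1 give the total mass;
  indicators of moved coordinates give the increment bound.\<close>

lemma sum_weight_eq:
  assumes "y \<in> space S"
  shows "(\<Sum>j\<in>I. a j * weight j y) =
    (\<integral>z. (\<Sum>j\<in>I. a j * (\<Sum>l<card I. of_bool (tie y j l z))) / real (card I) \<partial>M)"
proof -
  have int: "integrable M (\<lambda>z. of_bool (tie y j l z) :: real)" if "j \<in> I" for j l
    by (intro integrable_bounded_rv bounded_rv_of_bool pred_tie assms that)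
  have "(\<integral>z. (\<Sum>j\<in>I. a j * (\<Sum>l<card I. of_bool (tie y j l z))) / real (card I) \<partial>M)
      = (\<Sum>j\<in>I. a j * (\<Sum>l<card I. (\<integral>z. of_bool (tie y j l z) \<partial>M))) / real (card I)"
    using int by (simp add: Bochner_Integration.integral_sum del: sum_of_bool_eq)
  then show ?thesis
    unfolding weight_def cell_def integral_of_bool
    by (simp only: sum_divide_distrib[of _ I] times_divide_eq_right)
qed

lemma sum_weight_le_1:
  assumes "y \<in> space S" shows "(\<Sum>j\<in>I. weight j y) \<le> 1"
proof -
  have "(\<Sum>j\<in>I. 1 * weight j y) \<le> (\<integral>z. 1 \<partial>M)"
    unfolding sum_weight_eq[OF assms]
  proof (rule integral_mono)
    fix z
    show "(\<Sum>j\<in>I. 1 * (\<Sum>l<card I. of_bool (tie y j l z))) / real (card I) \<le> 1"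
      using card_ties_le[of y z] card_ties[of y z] by (cases "card I = 0") (auto simp: divide_le_eq_1)
  qed (use integrable_bounded_rv[OF bounded_rv_ties[OF assms, of "\<lambda>_. 1"]] in auto)
  then show ?thesis by (simp add: prob_space)
qed

text \<open>Argued for each \<open>z\<close>: if \<open>y\<close> covers it and \<open>x\<close>
  does not, every \<open>j\<close> near \<open>z\<close> in \<open>y\<close> has moved. All ties of
  \<open>z\<close> are then counted, and there are enough of them for \<open>?W z\<close> to reach
  1.\<close>

lemma hamming_lipschitz_uncovered_mass: "hamming_lipschitz I uncovered_mass weight"
  unfolding hamming_lipschitz_def
proof (intro conjI ballI finite_I bounded_rv_uncovered_mass bounded_rv_weight weight_nonneg)
  fix x y assume x: "x \<in> space S" and y: "y \<in> space S"
  let ?d = "\<lambda>j. of_bool (x j \<noteq> y j) :: real"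
  have int: "bounded_rv M (\<lambda>z. of_bool (\<forall>k\<in>I. \<not> R (u k) z))" if "u \<in> space S" for u
    using that finite_I
    by (intro bounded_rv_of_bool pred_intros_logic pred_intros_finite measurable_R_coords measurable_const)
       (auto intro: space_sample_coord)
  let ?W = "\<lambda>z. (\<Sum>j\<in>I. ?d j * (\<Sum>l<card I. of_bool (tie y j l z))) / real (card I)"
  have "uncovered_mass x = (\<integral>z. of_bool (\<forall>k\<in>I. \<not> R (x k) z) \<partial>M)"
    by (simp add: uncovered_mass_def integral_of_bool)
  also have "\<dots> \<le> (\<integral>z. of_bool (\<forall>k\<in>I. \<not> R (y k) z) + ?W z \<partial>M)"
  proof (intro integral_mono integrable_bounded_rv bounded_rv_add int x y bounded_rv_ties)
    fix z
    have W: "0 \<le> ?W z" by (intro divide_nonneg_nonneg sum_nonneg mult_nonneg_nonneg) auto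
    show "of_bool (\<forall>k\<in>I. \<not> R (x k) z) \<le> of_bool (\<forall>k\<in>I. \<not> R (y k) z) + ?W z"
    proof (cases "(\<forall>k\<in>I. \<not> R (x k) z) \<and> \<not> (\<forall>k\<in>I. \<not> R (y k) z)")
      case True
      then obtain k where k: "k \<in> I" "R (y k) z" by auto
      have "?d j * of_bool (tie y j l z) = of_bool (tie y j l z)" if "j \<in> I" for j l
        using True that by (cases "x j = y j") (auto simp: tie_def)
      then have "(\<Sum>j\<in>I. ?d j * (\<Sum>l<card I. of_bool (tie y j l z))) = real (card (ties y z))"
        unfolding card_ties sum_distrib_left by (intro sum.cong refl)
      moreover have "0 < card I" using k finite_I by (auto simp: card_gt_0_iff)
      ultimately have "1 \<le> ?W z"
        using card_ties_ge[where y = y, OF k] by simp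
      then show ?thesis using True by simp
    qed (use W in auto)
  qed
  also have "\<dots> = uncovered_mass y + (\<Sum>j\<in>I. ?d j * weight j y)"
    unfolding sum_weight_eq[OF y]
    by (subst Bochner_Integration.integral_add)
       (auto intro!: integrable_bounded_rv int[OF y] bounded_rv_ties[OF y] simp: uncovered_mass_def integral_of_bool
         simp del: sum_of_bool_eq)
  finally show "uncovered_mass x \<le> uncovered_mass y + (\<Sum>j\<in>I. weight j y * ?d j)"
    by (simp add: mult.commute)
qed

end

section \<open>Compensated hit counts control the weights\<close>

lemma (in prob_space) integral_exp_minus_of_bool:
  assumes "Measurable.pred M P"
  shows "(\<integral>z. exp (- of_bool (P z)) \<partial>M) \<le> exp (- (prob {z \<in> space M. P z} / 2))"
proof -
  let ?p = "prob {z \<in> space M. P z}"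
  \<comment> \<open>Since \<open>1 - 1 / e >= 1 / 2\<close>, half of each cell is compensated by its
    hit; this is the source of the factor 2 in the bounds on \<open>weight_sq\<close>.\<close>
  have "exp (- 1 :: real) \<le> 1 / 2"
    using exp_ge_add_one_self[of "1 :: real"] by (simp add: exp_minus field_simps)
  then have "exp (- of_bool (P z)) \<le> 1 - of_bool (P z) / (2 :: real)" for z
    by (cases "P z") auto
  then have "(\<integral>z. exp (- of_bool (P z)) \<partial>M) \<le> (\<integral>z. 1 - of_bool (P z) / (2 :: real) \<partial>M)"
    by (intro integral_mono integrable_bounded_rv bounded_rv_intros bounded_rv_of_bool assms)
  also have "\<dots> = 1 - ?p / 2"
    using integrable_bounded_rv[OF bounded_rv_of_bool[OF assms]]
    by (simp add: integral_of_bool prob_space)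
  also have "\<dots> \<le> exp (- (?p / 2))"
    using exp_ge_add_one_self[of "- (?p / 2)"] by simp
  finally show ?thesis .
qed

context cyclic_proximity_sample
begin

text \<open>The next point of the cycle must avoid all earlier successors of \<open>j\<close>, not
  merely the selected ones, so that its conditional probability is exactly a
  \<open>cell\<close>.\<close>

definition hit :: "(nat \<Rightarrow> 'a) \<Rightarrow> nat \<Rightarrow> nat \<Rightarrow> bool" where
  "hit y j l \<longleftrightarrow> tie y j l (y ((c ^^ Suc l) j))"

lemma pred_hit: "j \<in> I \<Longrightarrow> Measurable.pred S (\<lambda>y. hit y j l)"
proof -
  assume j: "j \<in> I"
  then have [measurable]: "\<And>i. (c ^^ i) j \<in> I" "j \<in> I" using funpow_c_in by auto
  show ?thesis
    unfolding hit_def tie_def by measurable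
qed

lemma bounded_rv_cell_minus_hit:
  assumes "j \<in> I" shows "bounded_rv S (\<lambda>y. \<Sum>l<m. cell y j l / 2 - of_bool (hit y j l))"
  by (intro bounded_rv_sum bounded_rv_diff bounded_rv_divide bounded_rv_cell bounded_rv_of_bool pred_hit assms)

text \<open>The integrand is a supermartingale in \<open>m\<close>: coordinate \<open>(c ^^ Suc m) j\<close> enters only through
  the last \<open>hit\<close>, whose conditional probability is \<open>cell y j m\<close>.\<close>

lemma exp_cell_minus_hit_le_1:
  assumes j: "j \<in> I" and "m < card I"
  shows "(\<integral>y. exp (\<Sum>l<m. cell y j l / 2 - of_bool (hit y j l)) \<partial>S) \<le> 1"
  using assms(2)
proof (induction m)
  case 0
  show ?case by (simp add: sample.prob_space)
next
  case (Suc m)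
  define k where "k = (c ^^ Suc m) j"
  have k: "k \<in> I" unfolding k_def by (rule funpow_c_in[OF j])
  have Ik: "insert k (I - {k}) = I" using k by auto
  have ne: "(c ^^ i) j \<noteq> k" if "i \<le> m" for i
    unfolding k_def using funpow_c_eq_iff[OF j, of i "Suc m"] Suc.prems that by auto
  let ?N = "PiM (I - {k}) (\<lambda>_. M)"
  let ?X = "\<lambda>m y. \<Sum>l<m. cell y j l / 2 - of_bool (hit y j l)"
  note split = integral_sample_inner[of "I - {k}" k, unfolded Ik]
  note inner = bounded_rv_sample_inner[of k "I - {k}", unfolded Ik]
  interpret N: prob_space ?N by (rule prob_space_sample)
  have bX: "bounded_rv S (\<lambda>y. exp (?X m y))" for m
    by (intro bounded_rv_exp bounded_rv_cell_minus_hit j)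
  have int: "integrable ?N (\<lambda>x. \<integral>z. exp (?X m (x(k := z))) \<partial>M)" for m
    by (rule N.integrable_bounded_rv[OF inner[OF bX]])
  have "(\<integral>y. exp (?X (Suc m) y) \<partial>S) \<le> (\<integral>y. exp (?X m y) \<partial>S)"
    unfolding split[OF finite_Diff[OF finite_I] _ bX, simplified]
  proof (rule integral_mono[OF int int])
    fix x assume x: "x \<in> space ?N"
    \<comment> \<open>An arbitrary value for coordinate \<open>k\<close>; no cell up to level
      \<open>m\<close> and no earlier hit reads it.\<close>
    obtain z0 where z0: "z0 \<in> space M" using not_empty by auto
    define y where "y = x(k := z0)"
    have y: "y \<in> space S"
      using space_sample_fun_upd[OF x z0, of k] unfolding Ik y_def .
    have tie_eq: "tie (x(k := z)) j l w \<longleftrightarrow> tie y j l w" if "l \<le> m" for z l w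
    proof -
      have "(x(k := z)) ((c ^^ i) j) = y ((c ^^ i) j)" if "i \<le> l" for i
        using ne[of i] that \<open>l \<le> m\<close> by (simp add: y_def)
      from this[of 0] this show ?thesis unfolding tie_def by auto
    qed
    have cell_eq: "cell (x(k := z)) j l = cell y j l" if "l \<le> m" for z l
      unfolding cell_def tie_eq[OF that] ..
    have hit_eq: "hit (x(k := z)) j l \<longleftrightarrow> hit y j l" if "l < m" for z l
    proof -
      have "(x(k := z)) ((c ^^ Suc l) j) = y ((c ^^ Suc l) j)"
        using ne[of "Suc l"] that by (simp add: y_def)
      then show ?thesis unfolding hit_def using tie_eq[of l] that by simp
    qed
    have hit_m: "hit (x(k := z)) j m \<longleftrightarrow> tie y j m z" for z
      unfolding hit_def k_def[symmetric] tie_eq[OF order_refl] by simp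
    have X_eq: "?X m (x(k := z)) = ?X m y" for z
      using cell_eq hit_eq by (intro sum.cong refl) auto
    have "(\<integral>z. exp (?X (Suc m) (x(k := z))) \<partial>M) =
        (\<integral>z. exp (?X m y + cell y j m / 2) * exp (- of_bool (tie y j m z)) \<partial>M)"
      by (intro Bochner_Integration.integral_cong refl)
         (simp only: sum.lessThan_Suc X_eq cell_eq[OF order_refl] hit_m flip: exp_add, simp)
    also have "\<dots> = exp (?X m y + cell y j m / 2) * (\<integral>z. exp (- of_bool (tie y j m z)) \<partial>M)"
      by simp
    also have "\<dots> \<le> exp (?X m y + cell y j m / 2) * exp (- (cell y j m / 2))"
      unfolding cell_def
      by (intro mult_left_mono integral_exp_minus_of_bool pred_tie y j) auto
    also have "\<dots> = exp (?X m y)"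
      by (simp flip: exp_add)
    also have "\<dots> = (\<integral>z. exp (?X m (x(k := z))) \<partial>M)"
      unfolding X_eq by (simp add: prob_space)
    finally show "(\<integral>z. exp (?X (Suc m) (x(k := z))) \<partial>M) \<le> (\<integral>z. exp (?X m (x(k := z))) \<partial>M)" .
  qed
  with Suc show ?case by simp
qed

text \<open>The hitting points are near \<open>j\<close>, and each is far from its predecessors on
  the walk, so they are separated. Stopping at \<open>card I - 1\<close> keeps the walk from
  returning to \<open>j\<close>.\<close>

lemma AE_hits_le: "AE y in S. \<forall>j\<in>I. (\<Sum>l<card I - 1. of_bool (hit y j l)) \<le> real (loc_sep_num y)"
  using AE_neighbourhood_loc_sep
proof eventually_elim
  case (elim y)
  show ?case
  proof
    fix j assume j: "j \<in> I"
    define L where "L = {l. l < card I - 1 \<and> hit y j l}"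
    define K where "K = (\<lambda>l. (c ^^ Suc l) j) ` L"
    have inj: "inj_on (\<lambda>l. (c ^^ Suc l) j) L"
    proof (rule inj_onI)
      fix l m assume "l \<in> L" "m \<in> L" "(c ^^ Suc l) j = (c ^^ Suc m) j"
      then show "l = m"
        using funpow_c_eq_iff[OF j, of "Suc l" "Suc m"] by (auto simp: L_def)
    qed
    have KI: "K \<subseteq> I" unfolding K_def using funpow_c_in[OF j] by blast
    moreover have "j \<notin> K"
    proof
      assume "j \<in> K"
      then obtain l where l: "l \<in> L" and "(c ^^ 0) j = (c ^^ Suc l) j" by (auto simp: K_def)
      moreover from l(1) have "Suc l < card I" by (simp add: L_def less_diff_conv)
      ultimately show False
        using funpow_c_eq_iff[OF j, of 0 "Suc l"] by simp
    qed
    ultimately have "K \<subseteq> I - {j}" by auto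
    moreover have "separated y K"
    proof -
      have far: "\<not> R (y ((c ^^ Suc l) j)) (y ((c ^^ Suc m) j))" if "m \<in> L" "l < m" for l m
      proof -
        have "\<forall>i\<in>{1..m}. \<not> R (y ((c ^^ i) j)) (y ((c ^^ Suc m) j))"
          using that(1) by (simp add: L_def hit_def tie_def)
        moreover have "Suc l \<in> {1..m}" using that(2) by simp
        ultimately show ?thesis by (rule bspec)
      qed
      show ?thesis
        unfolding separated_def
      proof (intro ballI impI)
        fix a b assume ab: "a \<in> K" "b \<in> K" "a \<noteq> b"
        then obtain l m where lm: "l \<in> L" "m \<in> L" "a = (c ^^ Suc l) j" "b = (c ^^ Suc m) j" "l \<noteq> m"
          unfolding K_def by blast
        then show "\<not> R (y a) (y b)"
          using far[of m l] far[of l m] R_sym by (metis linorder_neqE_nat)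
      qed
    qed
    moreover have "\<forall>k\<in>K. R (y k) (y j)"
      using R_sym by (auto simp: K_def L_def hit_def tie_def)
    ultimately have "loc_sep y K" using elim j by blast
    then have "card K \<le> loc_sep_num y"
      unfolding loc_sep_num_def by (intro card_le_max_card finite_I KI)
    moreover have "card K = card L" unfolding K_def by (rule card_image[OF inj])
    moreover have "(\<Sum>l<card I - 1. of_bool (hit y j l)) = real (card L)"
      by (simp add: L_def Int_def)
    ultimately show "(\<Sum>l<card I - 1. of_bool (hit y j l)) \<le> real (loc_sep_num y)" by simp
  qed
qed

lemma cell_antimono:
  assumes "y \<in> space S" "j \<in> I" "l \<le> m" shows "cell y j m \<le> cell y j l"
  unfolding cell_def
proof (rule finite_measure_mono)
  show "{z \<in> space M. tie y j l z} \<in> sets M"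
    using pred_tie[OF assms(1,2)] by simp
qed (use assms(3) in \<open>auto simp: tie_def\<close>)

text \<open>The last cell has no hit to compensate it. As cells decrease in \<open>l\<close>, it is
  at most the average of the others; this is where \<open>n - 1\<close> replaces
  \<open>n\<close>.\<close>

lemma weight_le_cells:
  assumes "y \<in> space S" "j \<in> I"
  shows "(real (card I) - 1) * weight j y \<le> (\<Sum>l<card I - 1. cell y j l)"
proof -
  obtain m where m: "card I = Suc m"
    using assms(2) finite_I by (metis card_gt_0_iff empty_iff gr0_implies_Suc)
  have "(\<Sum>l<m. cell y j m) \<le> (\<Sum>l<m. cell y j l)"
    using assms by (intro sum_mono cell_antimono) auto
  then have "real m * (\<Sum>l<Suc m. cell y j l) \<le> real (Suc m) * (\<Sum>l<m. cell y j l)"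
    by (simp add: algebra_simps)
  then show ?thesis
    by (simp add: weight_def m field_simps)
qed

lemma exp_weight_le_1:
  assumes j: "j \<in> I"
  shows "(\<integral>y. exp ((real (card I) - 1) / 2 * weight j y - real (loc_sep_num y)) \<partial>S) \<le> 1"
proof -
  have "(\<integral>y. exp ((real (card I) - 1) / 2 * weight j y - real (loc_sep_num y)) \<partial>S)
    \<le> (\<integral>y. exp (\<Sum>l<card I - 1. cell y j l / 2 - of_bool (hit y j l)) \<partial>S)"
  proof (rule integral_mono_AE)
    show "integrable S (\<lambda>y. exp ((real (card I) - 1) / 2 * weight j y - real (loc_sep_num y)))"
      by (intro sample.integrable_bounded_rv bounded_rv_exp bounded_rv_diff bounded_rv_mult
          bounded_rv_const bounded_rv_weight bounded_rv_loc_sep_num j)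
    show "integrable S (\<lambda>y. exp (\<Sum>l<card I - 1. cell y j l / 2 - of_bool (hit y j l)))"
      by (intro sample.integrable_bounded_rv bounded_rv_exp bounded_rv_cell_minus_hit j)
    show "AE y in S. exp ((real (card I) - 1) / 2 * weight j y - real (loc_sep_num y))
        \<le> exp (\<Sum>l<card I - 1. cell y j l / 2 - of_bool (hit y j l))"
      using AE_hits_le AE_space
    proof eventually_elim
      case (elim y)
      then show ?case
        using weight_le_cells[of y j] j
        by (auto simp: sum_subtractf sum_divide_distrib[symmetric] simp del: sum_of_bool_eq)
    qed
  qed
  also have "\<dots> \<le> 1"
  proof (rule exp_cell_minus_hit_le_1[OF j])
    have "0 < card I" using j finite_I by (auto simp: card_gt_0_iff)
    then show "card I - 1 < card I" by simp
  qed
  finally show ?thesis .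
qed

section \<open>Mean and tail of the sum of squared weights\<close>

definition weight_sq :: "(nat \<Rightarrow> 'a) \<Rightarrow> real" where
  "weight_sq y = (\<Sum>j\<in>I. (weight j y)\<^sup>2)"

lemma bounded_rv_weight_sq: "bounded_rv S weight_sq"
  unfolding weight_sq_def by (intro bounded_rv_sum bounded_rv_power bounded_rv_weight)

text \<open>A sum of squares is at most the maximum times the sum, and the weights sum to at most 1.
  The index depends on \<open>y\<close>.\<close>

lemma weight_sq_le_weight:
  assumes "y \<in> space S" "I \<noteq> {}"
  obtains j where "j \<in> I" "weight_sq y \<le> weight j y"
proof -
  obtain j where j: "j \<in> I" "\<forall>i\<in>I. weight i y \<le> weight j y"
  proof -
    have "Max ((\<lambda>i. weight i y) ` I) \<in> (\<lambda>i. weight i y) ` I"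
      using finite_I assms(2) by (intro Max_in) auto
    then obtain j where "j \<in> I" "weight j y = Max ((\<lambda>i. weight i y) ` I)" by auto
    then show thesis using finite_I by (intro that[of j]) auto
  qed
  have "weight_sq y \<le> (\<Sum>i\<in>I. weight j y * weight i y)"
    unfolding weight_sq_def power2_eq_square
    using j weight_nonneg by (intro sum_mono mult_right_mono) auto
  also have "\<dots> = weight j y * (\<Sum>i\<in>I. weight i y)" by (simp add: sum_distrib_left)
  also have "\<dots> \<le> weight j y * 1"
    using sum_weight_le_1[OF assms(1)] weight_nonneg by (intro mult_left_mono) auto
  finally show thesis using that j by simp
qed

text \<open>The random maximising index is handled by summing over all \<open>j\<close>; the
  resulting factor becomes \<open>ln n\<close> in the mean bound and \<open>n\<close> in the tail
  bound.\<close>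

lemma exp_weight_sq_le:
  assumes "I \<noteq> {}"
  shows "(\<integral>y. exp ((real (card I) - 1) / 2 * weight_sq y - real (loc_sep_num y)) \<partial>S) \<le> real (card I)"
proof -
  have n: "1 \<le> real (card I)"
    using assms finite_I by (simp add: Suc_le_eq card_gt_0_iff)
  let ?e = "\<lambda>j y. exp ((real (card I) - 1) / 2 * weight j y - real (loc_sep_num y))"
  have be: "bounded_rv S (?e j)" if "j \<in> I" for j
    by (intro bounded_rv_exp bounded_rv_diff bounded_rv_mult bounded_rv_const bounded_rv_weight
        bounded_rv_loc_sep_num that)
  have "(\<integral>y. exp ((real (card I) - 1) / 2 * weight_sq y - real (loc_sep_num y)) \<partial>S) \<le> (\<integral>y. (\<Sum>j\<in>I. ?e j y) \<partial>S)"
  proof (intro integral_mono sample.integrable_bounded_rv)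
    show "bounded_rv S (\<lambda>y. exp ((real (card I) - 1) / 2 * weight_sq y - real (loc_sep_num y)))"
      by (intro bounded_rv_exp bounded_rv_diff bounded_rv_mult bounded_rv_const bounded_rv_weight_sq
        bounded_rv_loc_sep_num)
    show "bounded_rv S (\<lambda>y. \<Sum>j\<in>I. ?e j y)"
      by (intro bounded_rv_sum be)
    fix y assume "y \<in> space S"
    then obtain j where j: "j \<in> I" "weight_sq y \<le> weight j y"
      using assms by (rule weight_sq_le_weight)
    have "exp ((real (card I) - 1) / 2 * weight_sq y - real (loc_sep_num y)) \<le> ?e j y"
      using j n by (simp add: mult_left_mono)
    also have "\<dots> \<le> (\<Sum>j\<in>I. ?e j y)"
      using finite_I j by (intro member_le_sum) auto
    finally show "exp ((real (card I) - 1) / 2 * weight_sq y - real (loc_sep_num y)) \<le> (\<Sum>j\<in>I. ?e j y)" .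
  qed
  also have "\<dots> = (\<Sum>j\<in>I. \<integral>y. ?e j y \<partial>S)"
    by (intro Bochner_Integration.integral_sum sample.integrable_bounded_rv be)
  also have "\<dots> \<le> (\<Sum>j\<in>I. 1)"
    by (intro sum_mono exp_weight_le_1)
  finally show ?thesis by simp
qed

lemma expectation_weight_sq_le:
  assumes "2 \<le> card I"
  shows "(\<integral>y. weight_sq y \<partial>S) \<le> 2 * ((\<integral>y. real (loc_sep_num y) \<partial>S) + ln (real (card I))) / (real (card I) - 1)"
proof -
  have I: "I \<noteq> {}" using assms by auto
  let ?f = "\<lambda>y. (real (card I) - 1) / 2 * weight_sq y - real (loc_sep_num y)"
  note b = bounded_rv_weight_sq bounded_rv_loc_sep_num
  have "bounded_rv S ?f"
    by (intro bounded_rv_diff bounded_rv_mult bounded_rv_const b)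
  then have "exp (\<integral>y. ?f y \<partial>S) \<le> real (card I)"
    using sample.exp_integral_le exp_weight_sq_le[OF I] order_trans by blast
  then have "(\<integral>y. ?f y \<partial>S) \<le> ln (real (card I))"
    using assms by (subst ln_ge_iff) auto
  moreover have "(\<integral>y. ?f y \<partial>S) = (real (card I) - 1) / 2 * (\<integral>y. weight_sq y \<partial>S) - (\<integral>y. real (loc_sep_num y) \<partial>S)"
    using b[THEN sample.integrable_bounded_rv] by simp
  ultimately show ?thesis
    using assms by (simp add: field_simps)
qed

text \<open>Off two events, \<open>(n - 1) / 2 * weight_sq\<close> is at most \<open>h + t\<close>,
  and \<open>h\<close> is at most \<open>2 * E h + 2 * t\<close>; together these give
  \<open>2 * E h + 3 * t\<close>.\<close>

lemma weight_sq_tail: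
  assumes "2 \<le> card I"
  shows "sample.prob {y \<in> space S. 2 * (2 * (\<integral>y. real (loc_sep_num y) \<partial>S) + 3 * t) / (real (card I) - 1) < weight_sq y}
    \<le> (real (card I) + 1) * exp (- t)"
proof -
  have I: "I \<noteq> {}" using assms by auto
  let ?m = "\<integral>y. real (loc_sep_num y) \<partial>S" and ?n = "real (card I) - 1"
  let ?A = "{y \<in> space S. t < ?n / 2 * weight_sq y - real (loc_sep_num y)}"
  let ?B = "{y \<in> space S. 2 * ?m + 2 * t < real (loc_sep_num y)}"
  note b = bounded_rv_weight_sq bounded_rv_loc_sep_num
  note [measurable] = b[THEN bounded_rv_measurable]
  have "sample.prob ?A = (\<integral>y. indicator ?A y \<partial>S)" by simp
  also have "\<dots> \<le> (\<integral>y. exp (?n / 2 * weight_sq y - real (loc_sep_num y)) * exp (- t) \<partial>S)"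
  proof (intro integral_mono sample.integrable_bounded_rv)
    show "bounded_rv S (indicator ?A)"
      by (intro bounded_rvI[where B = 1]) (auto simp: indicator_def)
    show "bounded_rv S (\<lambda>y. exp (?n / 2 * weight_sq y - real (loc_sep_num y)) * exp (- t))"
      by (intro bounded_rv_exp bounded_rv_diff bounded_rv_mult bounded_rv_const b)
    fix y
    show "indicator ?A y \<le> exp (?n / 2 * weight_sq y - real (loc_sep_num y)) * exp (- t)"
      by (auto simp: indicator_def simp flip: exp_add)
  qed
  also have "\<dots> \<le> real (card I) * exp (- t)"
    using exp_weight_sq_le[OF I] by simp
  finally have A: "sample.prob ?A \<le> real (card I) * exp (- t)" .
  have "sample.prob {y \<in> space S. 2 * (2 * ?m + 3 * t) / ?n < weight_sq y} \<le> sample.prob (?A \<union> ?B)"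
  proof (rule sample.finite_measure_mono)
    show "{y \<in> space S. 2 * (2 * ?m + 3 * t) / ?n < weight_sq y} \<subseteq> ?A \<union> ?B"
    proof safe
      fix y assume "2 * (2 * ?m + 3 * t) / ?n < weight_sq y" and "\<not> 2 * ?m + 2 * t < real (loc_sep_num y)"
      moreover have "0 < ?n" using assms by simp
      ultimately show "t < ?n / 2 * weight_sq y - real (loc_sep_num y)"
        by (simp add: field_simps)
    qed
  qed measurable
  also have "\<dots> \<le> sample.prob ?A + sample.prob ?B"
    by (intro measure_Un_le) measurable
  also have "\<dots> \<le> real (card I) * exp (- t) + exp (- t)"
    using A loc_sep_num_tail by (intro add_mono)
  finally show ?thesis by (simp add: algebra_simps)
qed

end

section \<open>Concentration bounds\<close>

context cyclic_proximity_sample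
begin

abbreviation "mean_loc_sep \<equiv> \<integral>y. real (loc_sep_num y) \<partial>S"

lemma isolated_variance_bounds:
  assumes "I \<noteq> {}"
  shows "(\<integral>y. (isolated_count y / card I - (\<integral>y. isolated_count y / card I \<partial>S))\<^sup>2 \<partial>S) \<le> 2 * (1 + mean_loc_sep) / card I"
    and "(\<integral>y. (\<Sum>j\<in>I. ((1 + real (cluster_num j y)) / card I)\<^sup>2) \<partial>S) \<le> 2 * (1 + mean_loc_sep) / card I"
    and "AE y in S. (\<Sum>j\<in>I. ((1 + real (cluster_num j y)) / card I)\<^sup>2) \<le> 2 * (1 + real (loc_sep_num y)) / card I"
proof -
  have n: "0 < card I" using assms finite_I by (simp add: card_gt_0_iff)
  show ae: "AE y in S. (\<Sum>j\<in>I. ((1 + real (cluster_num j y)) / card I)\<^sup>2) \<le> 2 * (1 + real (loc_sep_num y)) / card I"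
    using AE_sum_cluster_weights_le
  proof eventually_elim
    case (elim y)
    have "(\<Sum>j\<in>I. ((1 + real (cluster_num j y)) / card I)\<^sup>2) = (\<Sum>j\<in>I. (1 + real (cluster_num j y))\<^sup>2) / (real (card I))\<^sup>2"
      by (simp add: power_divide sum_divide_distrib)
    also have "\<dots> \<le> (2 * (1 + real (loc_sep_num y)) * real (card I)) / (real (card I))\<^sup>2"
      using elim by (intro divide_right_mono) auto
    finally show ?case using n by (simp add: power2_eq_square)
  qed
  have "(\<integral>y. (\<Sum>j\<in>I. ((1 + real (cluster_num j y)) / card I)\<^sup>2) \<partial>S) \<le> (\<integral>y. 2 * (1 + real (loc_sep_num y)) / card I \<partial>S)"
    by (intro integral_mono_AE ae sample.integrable_bounded_rv bounded_rv_divide bounded_rv_sum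
        bounded_rv_power bounded_rv_add bounded_rv_mult bounded_rv_const bounded_rv_cluster_num bounded_rv_loc_sep_num)
  also have "\<dots> = 2 * (1 + mean_loc_sep) / card I"
    using sample.integrable_bounded_rv[OF bounded_rv_loc_sep_num] by (simp add: sample.prob_space)
  finally show le: "(\<integral>y. (\<Sum>j\<in>I. ((1 + real (cluster_num j y)) / card I)\<^sup>2) \<partial>S) \<le> 2 * (1 + mean_loc_sep) / card I" .
  show "(\<integral>y. (isolated_count y / card I - (\<integral>y. isolated_count y / card I \<partial>S))\<^sup>2 \<partial>S) \<le> 2 * (1 + mean_loc_sep) / card I"
    using hamming_lipschitz_variance[OF hamming_lipschitz_isolated] le by linarith
qed

text \<open>The bound is stated for any \<open>m\<close> above the mean, because the expectation of
  the original \<open>h\<close> may be larger than \<open>mean_loc_sep\<close>. The argument gives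
  three exponential terms: two from the deviation and one from the tail of
  \<open>loc_sep_num\<close>.\<close>

lemma isolated_tails:
  assumes "I \<noteq> {}" and m: "mean_loc_sep \<le> m" and t: "0 < t"
  shows "sample.prob {y \<in> space S.
      12 * sqrt ((1 + m) * t / card I) + 23 * t / sqrt (card I) < \<bar>isolated_count y / card I - (\<integral>y. isolated_count y / card I \<partial>S)\<bar>}
    \<le> 15 * exp (- t)"
proof -
  have n: "0 < real (card I)" using assms finite_I by (simp add: card_gt_0_iff)
  have m0: "0 \<le> mean_loc_sep" by simp
  have m1: "0 \<le> m" by (rule order_trans[OF m0 m])
  let ?s = "12 * sqrt ((1 + m) * t / card I) + 23 * t / sqrt (card I)"
  let ?w = "2 * (1 + (2 * mean_loc_sep + 2 * t)) / card I"
  let ?V = "\<lambda>y. \<Sum>j\<in>I. ((1 + real (cluster_num j y)) / card I)\<^sup>2"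
  have s: "0 < ?s" using n t m1 by (intro add_nonneg_pos) auto
  \<comment> \<open>The nonnegative cross term of the square is dropped.\<close>
  have "(12 * sqrt ((1 + m) * t / card I))\<^sup>2 + (23 * t / sqrt (card I))\<^sup>2 \<le> ?s\<^sup>2"
    using n t m1 by (simp add: power2_sum)
  then have s2: "(144 * ((1 + m) * t) + 529 * t\<^sup>2) / card I \<le> ?s\<^sup>2"
    using n t m1 by (simp add: power_mult_distrib power_divide add_divide_distrib)
  have mt: "mean_loc_sep * t \<le> m * t" "0 \<le> mean_loc_sep * t" using m m0 t by auto
  have expand: "144 * ((1 + m) * t) = 144 * t + 144 * (m * t)"
    by (simp add: algebra_simps)
  have "2 * (2 * (1 + mean_loc_sep) / card I) * t = (4 * t + 4 * (mean_loc_sep * t)) / card I"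
    by (simp add: field_simps)
  also have "\<dots> \<le> (144 * ((1 + m) * t) + 529 * t\<^sup>2) / card I"
    unfolding expand using n t mt zero_le_power2[of t] by (intro divide_right_mono) linarith+
  finally have 1: "2 * (2 * (1 + mean_loc_sep) / card I) * t \<le> ?s\<^sup>2" using s2 by linarith
  have "2 * ?w * t = (4 * t + 8 * (mean_loc_sep * t) + 8 * t\<^sup>2) / card I"
    by (simp add: field_simps power2_eq_square)
  also have "\<dots> \<le> (144 * ((1 + m) * t) + 529 * t\<^sup>2) / card I"
    unfolding expand using n t mt zero_le_power2[of t] by (intro divide_right_mono) linarith+
  finally have 2: "2 * ?w * t \<le> ?s\<^sup>2" using s2 by linarith
  have "sample.prob {y \<in> space S. ?w < ?V y} \<le> sample.prob {y \<in> space S. 2 * mean_loc_sep + 2 * t < real (loc_sep_num y)}"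
  proof (rule sample.finite_measure_mono_AE)
    show "AE y in S. y \<in> {y \<in> space S. ?w < ?V y} \<longrightarrow> y \<in> {y \<in> space S. 2 * mean_loc_sep + 2 * t < real (loc_sep_num y)}"
      using isolated_variance_bounds(3)[OF assms(1)]
    proof eventually_elim
      case (elim y)
      show ?case
      proof safe
        assume "?w < ?V y"
        then have "?w < 2 * (1 + real (loc_sep_num y)) / card I" using elim by linarith
        then show "2 * mean_loc_sep + 2 * t < real (loc_sep_num y)"
          using n by (simp add: divide_less_cancel)
      qed
    qed
    note [measurable] = bounded_rv_measurable[OF bounded_rv_loc_sep_num]
    show "{y \<in> space S. 2 * mean_loc_sep + 2 * t < real (loc_sep_num y)} \<in> sets S" by measurable
  qed
  also have "\<dots> \<le> exp (- t)" by (rule loc_sep_num_tail)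
  finally have "sample.prob {y \<in> space S. ?w < ?V y} \<le> exp (- t)" .
  moreover have "0 < 2 * (1 + mean_loc_sep) / card I" "0 < ?w"
    using n m0 t by (auto intro!: divide_pos_pos add_pos_nonneg)
  ultimately show ?thesis
    using hamming_lipschitz_tails[OF hamming_lipschitz_isolated s isolated_variance_bounds(2)[OF assms(1)] _ 1 _ 2]
      exp_gt_zero[of "- t"] by linarith
qed

lemma uncovered_variance:
  assumes "2 \<le> card I"
  shows "(\<integral>y. (uncovered_mass y - (\<integral>y. uncovered_mass y \<partial>S))\<^sup>2 \<partial>S)
    \<le> (2 * mean_loc_sep + 4 * (exp 1 - 2) * (ln (real (card I)) + 1)) / (real (card I) - 1)"
proof -
  \<comment> \<open>Hence \<open>4 * (exp 1 - 2) >= 2\<close>, which covers the coefficient of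
    \<open>ln n\<close>.\<close>
  have "5 / 2 \<le> (exp 1 :: real)"
    using exp_lower_Taylor_quadratic[of "1 :: real"] by simp
  then have "2 * (ln (real (card I)) + 1) \<le> 4 * (exp 1 - 2) * (ln (real (card I)) + 1)"
    using assms by (intro mult_right_mono) auto
  then have "2 * (mean_loc_sep + ln (real (card I))) / (real (card I) - 1)
      \<le> (2 * mean_loc_sep + 4 * (exp 1 - 2) * (ln (real (card I)) + 1)) / (real (card I) - 1)"
    using assms by (intro divide_right_mono) auto
  moreover have "(\<integral>y. (uncovered_mass y - (\<integral>y. uncovered_mass y \<partial>S))\<^sup>2 \<partial>S) \<le> (\<integral>y. weight_sq y \<partial>S)"
    unfolding weight_sq_def by (rule hamming_lipschitz_variance[OF hamming_lipschitz_uncovered_mass])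
  ultimately show ?thesis
    using expectation_weight_sq_le[OF assms] by linarith
qed

lemma uncovered_tails:
  assumes n: "16 \<le> card I" and m: "mean_loc_sep \<le> m" and t: "0 < t"
  shows "sample.prob {y \<in> space S.
      12 * sqrt (m * t / card I) + 37 * t / sqrt (real (card I) - 1) < \<bar>uncovered_mass y - (\<integral>y. uncovered_mass y \<partial>S)\<bar>}
    \<le> 2 * real (card I) * exp (- t)"
proof (cases "ln (real (card I)) \<le> t")
  \<comment> \<open>For \<open>t < ln n\<close> the right side exceeds 1. Otherwise
    \<open>ln n * t <= t^2\<close>, so the logarithm in the mean bound is absorbed by the term in
    \<open>t^2\<close>.\<close>
  case False
  then have "exp t \<le> real (card I)"
    using n by (subst ln_ge_iff[symmetric]) auto
  then have "1 \<le> 2 * real (card I) * exp (- t)"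
    using n by (simp add: exp_minus field_simps) 
  then show ?thesis
    using sample.prob_le_1 order_trans by blast
next
  case True
  have n1: "0 < real (card I) - 1" using n by simp
  have m0: "0 \<le> mean_loc_sep" by simp
  have m1: "0 \<le> m" by (rule order_trans[OF m0 m])
  let ?n = "real (card I)"
  let ?s = "12 * sqrt (m * t / ?n) + 37 * t / sqrt (?n - 1)"
  let ?v = "2 * (mean_loc_sep + ln ?n) / (?n - 1)"
  let ?w = "2 * (2 * mean_loc_sep + 3 * t) / (?n - 1)"
  have s: "0 < ?s" using n1 t m1 by (intro add_nonneg_pos) auto
  have "(12 * sqrt (m * t / ?n))\<^sup>2 + (37 * t / sqrt (?n - 1))\<^sup>2 \<le> ?s\<^sup>2"
    using n1 t m1 by (simp add: power2_sum)
  then have s2: "144 * (m * t) / ?n + 1369 * t\<^sup>2 / (?n - 1) \<le> ?s\<^sup>2"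
    using n1 t m1 by (simp add: power_mult_distrib power_divide)
  have mt: "mean_loc_sep * t \<le> m * t" "0 \<le> mean_loc_sep * t" using m m0 t by auto
  \<comment> \<open>The denominator \<open>n\<close> becomes \<open>n - 1\<close> by
    \<open>n <= 12 * (n - 1)\<close>, at the cost of lowering 144 to 12.\<close>
  have "12 * (mean_loc_sep * t) * ?n \<le> 144 * (m * t) * (?n - 1)"
  proof -
    have "12 * (mean_loc_sep * t) * ?n \<le> 12 * (m * t) * (12 * (?n - 1))"
      using mt m m1 t n by (intro mult_mono) auto
    then show ?thesis by (simp add: algebra_simps)
  qed
  then have "12 * (mean_loc_sep * t) / (?n - 1) \<le> 144 * (m * t) / ?n"
    using n1 n by (simp add: field_simps)
  then have s3: "(12 * (mean_loc_sep * t) + 1369 * t\<^sup>2) / (?n - 1) \<le> ?s\<^sup>2"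
    using s2 by (simp add: add_divide_distrib)
  have tt: "ln ?n * t \<le> t\<^sup>2" "0 \<le> t\<^sup>2" using True t by (auto simp: power2_eq_square)
  have "2 * ?v * t = (4 * (mean_loc_sep * t) + 4 * (ln ?n * t)) / (?n - 1)"
    by (simp add: field_simps)
  also have "\<dots> \<le> (12 * (mean_loc_sep * t) + 1369 * t\<^sup>2) / (?n - 1)"
    using n1 mt tt by (intro divide_right_mono) linarith+
  finally have 1: "2 * ?v * t \<le> ?s\<^sup>2" using s3 by linarith
  have "2 * ?w * t = (8 * (mean_loc_sep * t) + 12 * t\<^sup>2) / (?n - 1)"
    by (simp add: field_simps power2_eq_square)
  also have "\<dots> \<le> (12 * (mean_loc_sep * t) + 1369 * t\<^sup>2) / (?n - 1)"
    using n1 mt tt by (intro divide_right_mono) linarith+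
  finally have 2: "2 * ?w * t \<le> ?s\<^sup>2" using s3 by linarith
  have V: "(\<integral>y. (\<Sum>j\<in>I. (weight j y)\<^sup>2) \<partial>S) \<le> ?v"
    using expectation_weight_sq_le n unfolding weight_sq_def by simp
  have "sample.prob {y \<in> space S. ?w < (\<Sum>j\<in>I. (weight j y)\<^sup>2)} \<le> (?n + 1) * exp (- t)"
    using weight_sq_tail[of t] n unfolding weight_sq_def by simp
  moreover have "0 < ?v" "0 < ?w"
    using n n1 m0 t by (auto intro!: divide_pos_pos mult_pos_pos add_nonneg_pos)
  \<comment> \<open>Amounts to \<open>n >= 3\<close>.\<close>
  moreover have "2 * exp (- t) + (?n + 1) * exp (- t) \<le> 2 * ?n * exp (- t)"
    using n by (simp flip: distrib_right)
  ultimately show ?thesis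
    using hamming_lipschitz_tails[OF hamming_lipschitz_uncovered_mass s V _ 1 _ 2] by linarith
qed

end

section \<open>Almost everywhere equal modifications and the completed law\<close>

lemma borel_measurable_completion_AE:
  assumes "g \<in> borel_measurable N" "AE x in N. f x = g x"
  shows "f \<in> borel_measurable (completion N)"
proof (rule measurableI)
  fix A :: "'b set" assume A: "A \<in> sets borel"
  have "AE x in completion N. x \<in> g -` A \<inter> space N \<longleftrightarrow> x \<in> f -` A \<inter> space N"
    using assms(2) by (intro AE_completion) (auto elim: eventually_mono)
  moreover have "g -` A \<inter> space N \<in> sets (completion N)"
    using measurable_sets[OF assms(1) A] by auto
  ultimately show "f -` A \<inter> space (completion N) \<in> sets (completion N)"
    using completion.in_sets_AE by (metis Int_lower2 space_completion)
qed simp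

lemma integral_completion_AE:
  fixes g :: "'b \<Rightarrow> real"
  assumes "g \<in> borel_measurable N" "AE x in N. f x = g x"
  shows "(\<integral>x. f x \<partial>completion N) = (\<integral>x. g x \<partial>N)"
proof -
  have "(\<integral>x. f x \<partial>completion N) = (\<integral>x. g x \<partial>completion N)"
    using assms by (intro integral_cong_AE borel_measurable_completion_AE AE_completion measurable_completion) auto
  then show ?thesis by (simp add: integral_completion assms(1))
qed

lemma measure_completion_AE:
  assumes "Measurable.pred N Q" "AE x in N. P x \<longleftrightarrow> Q x"
  shows "measure (completion N) {x \<in> space (completion N). P x} = measure N {x \<in> space N. Q x}"
proof -
  have Q: "{x \<in> space N. Q x} \<in> sets N" using assms(1) by simp
  have ae: "AE x in completion N. x \<in> {x \<in> space N. Q x} \<longleftrightarrow> x \<in> {x \<in> space N. P x}"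
    using assms(2) by (intro AE_completion) (auto elim: eventually_mono)
  have "{x \<in> space N. P x} \<in> sets (completion N)"
    using Q by (intro completion.in_sets_AE[OF ae]) auto
  then have "measure (completion N) {x \<in> space N. P x} = measure (completion N) {x \<in> space N. Q x}"
    using Q ae by (intro measure_eq_AE) auto
  then show ?thesis using Q by simp
qed

text \<open>\<open>Q\<close> need not be measurable, so everything goes through a measurable null
  set \<open>N\<close> of pairs. Two distinct sample points, or a sample point and almost every
  \<open>z\<close>, form a pair outside \<open>N\<close>.\<close>

lemma (in proximity_sample) AE_relation_cong:
  assumes "AE p in M \<Otimes>\<^sub>M M. R (fst p) (snd p) \<longleftrightarrow> Q (fst p) (snd p)"
  shows "AE y in S. \<forall>i\<in>I. \<forall>j\<in>I. i \<noteq> j \<longrightarrow> (R (y i) (y j) \<longleftrightarrow> Q (y i) (y j))"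
    and "AE y in S. \<forall>j\<in>I. AE z in M. R (y j) z \<longleftrightarrow> Q (y j) z"
proof -
  interpret P: pair_prob_space M M ..
  from assms obtain N where N: "{p \<in> space (M \<Otimes>\<^sub>M M). \<not> (R (fst p) (snd p) \<longleftrightarrow> Q (fst p) (snd p))} \<subseteq> N"
      "emeasure (M \<Otimes>\<^sub>M M) N = 0" "N \<in> sets (M \<Otimes>\<^sub>M M)"
    by (rule AE_E)
  have "AE p in M \<Otimes>\<^sub>M M. p \<notin> N"
    using N by (intro AE_not_in) auto
  then have ae: "AE x in M. AE z in M. (x, z) \<notin> N"
    by (rule P.AE_pair)
  have good: "R x z \<longleftrightarrow> Q x z" if "(x, z) \<notin> N" "x \<in> space M" "z \<in> space M" for x z
    using that N(1) by (force simp: space_pair_measure)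
  have comp: "AE x in PiM J (\<lambda>_. M). AE z in M. (x i, z) \<notin> N" if "i \<in> J" for i and J :: "nat set"
    by (rule AE_PiM_component[OF _ that ae]) (rule prob_space_axioms)
  have "AE y in S. \<forall>i\<in>I. \<forall>j\<in>I. i \<noteq> j \<longrightarrow> (y i, y j) \<notin> N"
  proof (intro AE_finite_allI finite_I)
    fix i j assume ij: "i \<in> I" "j \<in> I"
    show "AE y in S. i \<noteq> j \<longrightarrow> (y i, y j) \<notin> N"
    proof (cases "i = j")
      case False
      have "AE y in S. (y i, y j) \<notin> N"
      proof (rule AE_sample_insert[OF finite_I ij(2)])
        show "Measurable.pred S (\<lambda>y. (y i, y j) \<notin> N)"
          using N(3) ij by measurable
        show "AE x in PiM (I - {j}) (\<lambda>_. M). AE z in M. ((x(j := z)) i, (x(j := z)) j) \<notin> N"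
          using comp[of i "I - {j}"] ij False by simp
      qed
      then show ?thesis by simp
    qed simp
  qed
  then show "AE y in S. \<forall>i\<in>I. \<forall>j\<in>I. i \<noteq> j \<longrightarrow> (R (y i) (y j) \<longleftrightarrow> Q (y i) (y j))"
    using AE_space
  proof eventually_elim
    case (elim y)
    then have "y i \<in> space M" if "i \<in> I" for i using that by (auto simp: space_PiM)
    then show ?case using elim(1) by (intro ballI impI good) blast+
  qed
  have "AE y in S. \<forall>j\<in>I. AE z in M. (y j, z) \<notin> N"
    by (intro AE_finite_allI finite_I comp)
  then show "AE y in S. \<forall>j\<in>I. AE z in M. R (y j) z \<longleftrightarrow> Q (y j) z"
    using AE_space
  proof eventually_elim
    case (elim y)
    show ?case
    proof
      fix j assume j: "j \<in> I"
      have "AE z in M. (y j, z) \<notin> N" using elim(1) j by auto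
      then show "AE z in M. R (y j) z \<longleftrightarrow> Q (y j) z"
        using AE_space
      proof eventually_elim
        case (elim z)
        then show ?case
          using \<open>y \<in> space S\<close> j by (intro good) (auto simp: space_PiM)
      qed
    qed
  qed
qed

section \<open>The concrete cycle and the concrete separation number\<close>

lemma bij_betw_of_surj:
  assumes "finite A" "f ` A = B" "card A = card B" shows "bij_betw f A B"
  using assms eq_card_imp_inj_on[of A f] by (simp add: bij_betw_def)

lemma cyclic_shift:
  fixes n :: nat
  defines "c \<equiv> \<lambda>i. Suc (i mod n)"
  assumes n: "0 < n"
  shows "bij_betw c {1..n} {1..n}"
    and "j \<in> {1..n} \<Longrightarrow> bij_betw (\<lambda>l. (c ^^ l) j) {..<card {1..n}} {1..n}"
proof -
  have pow: "(c ^^ l) j = Suc ((j - 1 + l) mod n)" if "j \<in> {1..n}" for j l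
    using that by (induction l) (auto simp: c_def mod_Suc_eq)
  have orbit: "(\<lambda>l. (c ^^ l) j) ` {..<n} = {1..n}" if j: "j \<in> {1..n}" for j
  proof
    show "(\<lambda>l. (c ^^ l) j) ` {..<n} \<subseteq> {1..n}"
      using n by (auto simp: pow[OF j] Suc_le_eq)
    show "{1..n} \<subseteq> (\<lambda>l. (c ^^ l) j) ` {..<n}"
    proof
      fix s assume s: "s \<in> {1..n}"
      \<comment> \<open>The number of steps from \<open>j\<close> to \<open>s\<close>; adding
        \<open>n\<close> avoids truncated subtraction.\<close>
      have "(j - 1 + (s + n - j) mod n) mod n = (j - 1 + (s + n - j)) mod n"
        by (rule mod_add_right_eq)
      also have "j - 1 + (s + n - j) = s - 1 + n"
        using j s by auto
      also have "(s - 1 + n) mod n = s - 1"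
        using s n by (simp only: mod_add_self2) auto
      finally have "s = (c ^^ ((s + n - j) mod n)) j"
        using s by (simp add: pow[OF j])
      then show "s \<in> (\<lambda>l. (c ^^ l) j) ` {..<n}" using n by auto
    qed
  qed
  show "bij_betw (\<lambda>l. (c ^^ l) j) {..<card {1..n}} {1..n}" if "j \<in> {1..n}"
    using orbit[OF that] by (intro bij_betw_of_surj) auto
  show "bij_betw c {1..n} {1..n}"
  proof (rule bij_betw_of_surj)
    show "c ` {1..n} = {1..n}"
    proof
      show "c ` {1..n} \<subseteq> {1..n}" using n by (auto simp: c_def Suc_le_eq)
      show "{1..n} \<subseteq> c ` {1..n}"
      proof
        fix s assume s: "s \<in> {1..n}"
        have "s = c (if s = 1 then n else s - 1)"
          using s by (auto simp: c_def)
        then show "s \<in> c ` {1..n}" using s by (intro image_eqI[of _ c "if s = 1 then n else s - 1"]) auto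
      qed
    qed
  qed auto
qed

text \<open>Filtering the list of indices keeps their order, so an index set becomes a subsequence
  of the same length.\<close>

lemma card_le_local_sep_number:
  assumes J: "J \<subseteq> {1..n}" and sep: "\<And>i j. i \<in> J \<Longrightarrow> j \<in> J \<Longrightarrow> i \<noteq> j \<Longrightarrow> r < d (x i) (x j)"
    and loc: "\<And>j. j \<in> J \<Longrightarrow> d (x j) z \<le> r"
  shows "card J \<le> local_sep_number d n r x"
proof -
  define ks where "ks = filter (\<lambda>i. i \<in> J) [1..<Suc n]"
  have set_ks: "set ks = J" and dist: "distinct ks"
    using J by (auto simp: ks_def)
  then have len: "length ks = card J" by (metis distinct_card)
  have in_J: "ks ! i \<in> J" if "i < length ks" for i using that set_ks nth_mem by blast
  have "local_sep d r (map x ks)"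
    unfolding local_sep_def
  proof (intro conjI exI[of _ z] allI impI)
    fix i j assume ij: "i < j \<and> j < length (map x ks)"
    then have "ks ! i \<noteq> ks ! j" using dist by (simp add: nth_eq_iff_index_eq)
    then show "r < d (map x ks ! i) (map x ks ! j)" using ij in_J sep by simp
  qed (use in_J loc in simp)
  moreover have "subseq (map x ks) (map x [1..<Suc n])"
    unfolding ks_def by (intro subseq_map subseq_filter_left)
  moreover have "finite {length ys |ys. subseq ys (map x [1..<Suc n]) \<and> local_sep d r ys}"
    by (rule finite_subset[of _ "{..n}"]) (auto dest: list_emb_length)
  ultimately show ?thesis
    unfolding local_sep_number_def using len by (intro Max_ge) (auto intro!: exI[of _ "map x ks"])
qed

lemma local_sep_number_le: "local_sep_number d n r x \<le> n"
proof -
  let ?L = "{length ys |ys. subseq ys (map x [1..<Suc n]) \<and> local_sep d r ys}"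
  have "?L \<subseteq> {..n}" by (auto dest: list_emb_length)
  moreover have "0 \<in> ?L" by (auto simp: local_sep_def intro!: exI[of _ "[]"])
  ultimately show ?thesis
    unfolding local_sep_number_def using finite_subset[of ?L "{..n}"] by (intro Max.boundedI) blast+
qed

section \<open>Almost sure identification with the stated quantities\<close>

theorem theorem2p7:
  fixes \<mu> :: "'a :: t2_space measure"
    and d :: "'a \<Rightarrow> 'a \<Rightarrow> real"
    and n :: nat and r :: real
  assumes "prob_space \<mu>" and "sets \<mu> = sets borel"
    and "continuous_on UNIV (\<lambda>(x, y). d x y)"
    and "\<And>x y. d x y \<ge> 0"
    and "\<And>x. d x x = 0"
    and "\<And>x y. d x y = d y x"
    and d_measurable: "(\<lambda>(x, y). d x y) \<in> borel_measurable (completion (\<mu> \<Otimes>\<^sub>M \<mu>))"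
    and h_measurable: "(\<lambda>x. real (local_sep_number d n r x)) \<in> borel_measurable (iid_sample n \<mu>)"
    and "n \<ge> 16" and "r \<ge> 0"
  defines "P \<equiv> iid_sample n \<mu>"
    and "G \<equiv> good_turing d n r"
    and "M \<equiv> missing_mass \<mu> d n r"
    and "h \<equiv> (\<lambda>x. real (local_sep_number d n r x))"
  shows "prob_space.variance P G \<le> 2 * (1 + prob_space.expectation P h) / real n
    \<and> prob_space.variance P M
           \<le> (2 * prob_space.expectation P h + 4 * (exp 1 - 2) * (ln (real n) + 1)) / (real n - 1)
    \<and> (\<forall>t>0.
           prob_space.prob P {x \<in> space P.
             \<bar>G x - prob_space.expectation P G\<bar>
               > 12 * sqrt ((1 + prob_space.expectation P h) * t / real n) + 23 * t / sqrt (real n)}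
           \<le> 15 * exp (- t))
    \<and> (\<forall>t>0.
           prob_space.prob P {x \<in> space P.
             \<bar>M x - prob_space.expectation P M\<bar>
               > 12 * sqrt (prob_space.expectation P h * t / real n) + 37 * t / sqrt (real n - 1)}
           \<le> 2 * real n * exp (- t))"
proof -
  interpret prob_space \<mu> by fact
  have space_mu: "space \<mu> = UNIV"
    using sets_eq_imp_space_eq[OF assms(2)] by simp
  have n: "0 < n" using \<open>n \<ge> 16\<close> by simp
  interpret pair: pair_prob_space \<mu> \<mu> ..
  \<comment> \<open>On a general Hausdorff space the product of the Borel sigma-algebras can be
    smaller than the Borel sigma-algebra of the product, so \<open>d\<close> is measurable only for
    the completion; \<open>g\<close> is a version measurable without it.\<close>
  obtain g where g: "g \<in> borel_measurable (\<mu> \<Otimes>\<^sub>M \<mu>)"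
    and ae_g: "AE p in \<mu> \<Otimes>\<^sub>M \<mu>. (case p of (x, y) \<Rightarrow> d x y) = g p"
    using completion_ex_borel_measurable_real[OF d_measurable] by blast
  \<comment> \<open>Symmetry of \<open>g\<close> may fail on a null set. Requiring both orders
    restores it, and invariance of the product under swapping keeps \<open>R\<close> almost
    everywhere correct.\<close>
  define R where "R x y \<longleftrightarrow> g (x, y) \<le> r \<and> g (y, x) \<le> r" for x y
  have swap: "(\<lambda>(x, y). (y, x)) \<in> measurable (\<mu> \<Otimes>\<^sub>M \<mu>) (\<mu> \<Otimes>\<^sub>M \<mu>)"
    by (rule measurable_pair_swap')
  have "AE p in \<mu> \<Otimes>\<^sub>M \<mu>. (case (case p of (x, y) \<Rightarrow> (y, x)) of (x, y) \<Rightarrow> d x y) = g (case p of (x, y) \<Rightarrow> (y, x))"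
  proof (rule AE_distrD[OF swap])
    show "AE p in distr (\<mu> \<Otimes>\<^sub>M \<mu>) (\<mu> \<Otimes>\<^sub>M \<mu>) (\<lambda>(x, y). (y, x)). (case p of (x, y) \<Rightarrow> d x y) = g p"
      by (subst pair.distr_pair_swap[symmetric]) (rule ae_g)
  qed
  with ae_g have R_ae: "AE p in \<mu> \<Otimes>\<^sub>M \<mu>. R (fst p) (snd p) \<longleftrightarrow> d (fst p) (snd p) \<le> r"
  proof eventually_elim
    case (elim p)
    then show ?case using assms(6)[of "fst p" "snd p"] by (cases p) (auto simp: R_def)
  qed
  interpret cyclic_proximity_sample \<mu> R "{1..n}" "\<lambda>i. Suc (i mod n)"
  proof
    have "(\<lambda>p. g (snd p, fst p)) \<in> borel_measurable (\<mu> \<Otimes>\<^sub>M \<mu>)"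
      using measurable_compose[OF swap g] by (simp add: case_prod_beta')
    then show "Measurable.pred (\<mu> \<Otimes>\<^sub>M \<mu>) (\<lambda>(x, y). R x y)"
      using g unfolding R_def by (simp add: case_prod_beta')
  qed (use cyclic_shift[OF n] in \<open>auto simp: R_def\<close>)
  have card: "card {1..n} = n" by simp
  have ne: "{1..n} \<noteq> {}" and card_ge: "16 \<le> card {1..n}"
    using \<open>n \<ge> 16\<close> by auto
  have P_eq: "P = completion S"
    by (simp add: P_def iid_sample_def)
  have h_int: "integrable P h"
  proof (rule finite_measure.integrable_const_bound[where B = "real n"])
    show "finite_measure P"
      unfolding P_eq by (intro finite_measureI) (simp del: One_nat_def add: sample.emeasure_space_1)
    show "h \<in> borel_measurable P" using h_measurable by (simp add: h_def P_def)
    show "AE x in P. norm (h x) \<le> real n"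
      by (rule AE_I2) (simp add: h_def local_sep_number_le)
  qed

  have G_ae: "AE y in S. G y = isolated_count y / real (card {1..n})"
    using AE_relation_cong(1)[OF R_ae]
  proof eventually_elim
    case (elim y)
    have "indicator (\<Inter>i\<in>{1..n} - {k}. - dball d (y i) r) (y k) = of_bool (isolated y k)" if "k \<in> {1..n}" for k
      using elim that unfolding indicator_def isolated_def dball_def by auto
    then have "(\<Sum>k = 1..n. indicator (\<Inter>i\<in>{1..n} - {k}. - dball d (y i) r) (y k)) = isolated_count y"
      unfolding isolated_count_def by (intro sum.cong refl)
    then show ?case
      by (simp add: G_def good_turing_def del: One_nat_def)
  qed
  have M_ae: "AE y in S. M y = uncovered_mass y"
    using AE_relation_cong(2)[OF R_ae] AE_space
  proof eventually_elim
    case (elim y)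
    \<comment> \<open>Equality almost everywhere yields equal measures only for measurable sets;
      closed balls settle this for the original one.\<close>
    have closed: "closed (dball d x r)" for x
      unfolding dball_def
      by (intro closed_Collect_le continuous_on_const continuous_on_compose2[OF assms(3), of UNIV "Pair x", simplified]
          continuous_intros)
    have "AE z in \<mu>. \<forall>k\<in>{1..n}. R (y k) z \<longleftrightarrow> d (y k) z \<le> r"
      using elim(1) by (intro AE_finite_allI) auto
    then have "AE z in \<mu>. z \<in> (\<Inter>k\<in>{1..n}. - dball d (y k) r) \<longleftrightarrow> z \<in> {z \<in> space \<mu>. \<forall>k\<in>{1..n}. \<not> R (y k) z}"
      by eventually_elim (auto simp: dball_def space_mu)
    moreover have "(\<Inter>k\<in>{1..n}. - dball d (y k) r) \<in> sets \<mu>"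
      unfolding assms(2) using n closed by (intro sets.finite_INT) (auto intro: borel_open borel_closed)
    moreover have "{z \<in> space \<mu>. \<forall>k\<in>{1..n}. \<not> R (y k) z} \<in> sets \<mu>"
    proof -
      have "Measurable.pred \<mu> (\<lambda>z. \<forall>k\<in>{1..n}. \<not> R (y k) z)"
        by (intro pred_intros_finite pred_intros_logic measurable_R_coords measurable_const)
           (auto simp: space_mu)
      then show ?thesis by simp
    qed
    ultimately show ?case
      unfolding M_def missing_mass_def uncovered_mass_def by (rule measure_eq_AE)
  qed
  have h_ae: "AE y in S. real (loc_sep_num y) \<le> h y"
    using AE_relation_cong[OF R_ae]
  proof eventually_elim
    case (elim y)
    let ?J = "witness y"
    have J: "?J \<subseteq> {1..n}" by (rule witness_props(1))
    have ae: "AE z in \<mu>. \<forall>k\<in>{1..n}. R (y k) z \<longleftrightarrow> d (y k) z \<le> r"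
      using elim(2) by (intro AE_finite_allI) auto
    \<comment> \<open>A set of positive measure cannot lie inside the null set where
      \<open>R\<close> and \<open>d\<close> disagree, so it contains a genuine common
      neighbour.\<close>
    have "\<exists>z. (\<forall>k\<in>{1..n}. R (y k) z \<longleftrightarrow> d (y k) z \<le> r) \<and> (\<forall>j\<in>?J. R (y j) z)"
    proof (rule ccontr)
      assume none: "\<not> ?thesis"
      have "AE z in \<mu>. \<not> (\<forall>j\<in>?J. R (y j) z)"
        using ae by eventually_elim (use none in blast)
      then have "emeasure \<mu> {z \<in> space \<mu>. \<forall>j\<in>?J. R (y j) z} = 0"
        by (rule emeasure_eq_0_AE)
      then show False using witness_props(2)[of y] by (simp add: loc_sep_def measure_def)
    qed
    then obtain z where z: "\<forall>k\<in>{1..n}. R (y k) z \<longleftrightarrow> d (y k) z \<le> r" "\<forall>j\<in>?J. R (y j) z"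
      by blast
    have "card ?J \<le> local_sep_number d n r y"
    proof (rule card_le_local_sep_number[OF J])
      fix i j assume ij: "i \<in> ?J" "j \<in> ?J" "i \<noteq> j"
      then have "\<not> R (y i) (y j)"
        using witness_props(2)[of y] by (auto simp: loc_sep_def separated_def)
      then show "r < d (y i) (y j)" using elim(1) ij J by (meson not_le subsetD)
    next
      fix j assume "j \<in> ?J"
      then show "d (y j) z \<le> r" using z J by blast
    qed
    then show ?case unfolding h_def witness_props(3) by simp
  qed

  note bounded_G = bounded_rv_divide[OF bounded_rv_isolated_count, of "real (card {1..n})"]
  note [measurable] = bounded_rv_measurable[OF bounded_G] bounded_rv_measurable[OF bounded_rv_uncovered_mass]
  have E_h: "mean_loc_sep \<le> (\<integral>y. h y \<partial>P)"
  proof -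
    have "mean_loc_sep = (\<integral>y. real (loc_sep_num y) \<partial>P)"
      unfolding P_eq by (rule integral_completion[symmetric]) (rule bounded_rv_measurable[OF bounded_rv_loc_sep_num])
    also have "\<dots> \<le> (\<integral>y. h y \<partial>P)"
    proof (rule integral_mono_AE[OF _ h_int])
      show "integrable P (\<lambda>y. real (loc_sep_num y))"
        unfolding P_eq integrable_completion[OF bounded_rv_measurable[OF bounded_rv_loc_sep_num]]
        by (rule sample.integrable_bounded_rv[OF bounded_rv_loc_sep_num])
      show "AE y in P. real (loc_sep_num y) \<le> h y"
        unfolding P_eq by (rule AE_completion[OF h_ae])
    qed
    finally show ?thesis .
  qed
  have E_G: "(\<integral>y. G y \<partial>P) = (\<integral>y. isolated_count y / real (card {1..n}) \<partial>S)"
    unfolding P_eq by (rule integral_completion_AE[OF _ G_ae]) measurable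
  have E_M: "(\<integral>y. M y \<partial>P) = (\<integral>y. uncovered_mass y \<partial>S)"
    unfolding P_eq by (rule integral_completion_AE[OF _ M_ae]) measurable

  have "(\<integral>y. (G y - (\<integral>y. G y \<partial>P))\<^sup>2 \<partial>P)
      = (\<integral>y. (isolated_count y / real (card {1..n}) - (\<integral>y. isolated_count y / real (card {1..n}) \<partial>S))\<^sup>2 \<partial>S)"
    unfolding E_G unfolding P_eq
  proof (rule integral_completion_AE)
    show "AE y in S. (G y - (\<integral>y. isolated_count y / real (card {1..n}) \<partial>S))\<^sup>2 =
        (isolated_count y / real (card {1..n}) - (\<integral>y. isolated_count y / real (card {1..n}) \<partial>S))\<^sup>2"
      using G_ae by eventually_elim (simp only:)
  qed measurable
  also have "\<dots> \<le> 2 * (1 + mean_loc_sep) / real (card {1..n})"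
    using n by (intro isolated_variance_bounds(1)) simp
  also have "\<dots> \<le> 2 * (1 + (\<integral>y. h y \<partial>P)) / real n"
    unfolding card using E_h by (intro divide_right_mono) auto
  finally have var_G: "(\<integral>y. (G y - (\<integral>y. G y \<partial>P))\<^sup>2 \<partial>P) \<le> 2 * (1 + (\<integral>y. h y \<partial>P)) / real n" .

  have "(\<integral>y. (M y - (\<integral>y. M y \<partial>P))\<^sup>2 \<partial>P) = (\<integral>y. (uncovered_mass y - (\<integral>y. uncovered_mass y \<partial>S))\<^sup>2 \<partial>S)"
    unfolding E_M unfolding P_eq
  proof (rule integral_completion_AE)
    show "AE y in S. (M y - (\<integral>y. uncovered_mass y \<partial>S))\<^sup>2 = (uncovered_mass y - (\<integral>y. uncovered_mass y \<partial>S))\<^sup>2"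
      using M_ae by eventually_elim (simp only:)
  qed measurable
  also have "\<dots> \<le> (2 * mean_loc_sep + 4 * (exp 1 - 2) * (ln (real n) + 1)) / (real n - 1)"
    using uncovered_variance \<open>n \<ge> 16\<close> by simp
  also have "\<dots> \<le> (2 * (\<integral>y. h y \<partial>P) + 4 * (exp 1 - 2) * (ln (real n) + 1)) / (real n - 1)"
    using E_h n by (intro divide_right_mono) auto
  finally have var_M: "(\<integral>y. (M y - (\<integral>y. M y \<partial>P))\<^sup>2 \<partial>P)
      \<le> (2 * (\<integral>y. h y \<partial>P) + 4 * (exp 1 - 2) * (ln (real n) + 1)) / (real n - 1)" .

  have dev_G: "measure P {x \<in> space P. s < \<bar>G x - (\<integral>y. G y \<partial>P)\<bar>} = measure S {x \<in> space S.
      s < \<bar>isolated_count x / real (card {1..n}) - (\<integral>y. isolated_count y / real (card {1..n}) \<partial>S)\<bar>}" for s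
    unfolding E_G unfolding P_eq
  proof (rule measure_completion_AE)
    show "AE x in S. (s < \<bar>G x - (\<integral>y. isolated_count y / real (card {1..n}) \<partial>S)\<bar>) =
        (s < \<bar>isolated_count x / real (card {1..n}) - (\<integral>y. isolated_count y / real (card {1..n}) \<partial>S)\<bar>)"
      using G_ae by eventually_elim (simp only:)
  qed measurable
  have dev_M: "measure P {x \<in> space P. s < \<bar>M x - (\<integral>y. M y \<partial>P)\<bar>} =
      measure S {x \<in> space S. s < \<bar>uncovered_mass x - (\<integral>y. uncovered_mass y \<partial>S)\<bar>}" for s
    unfolding E_M unfolding P_eq
  proof (rule measure_completion_AE)
    show "AE x in S. (s < \<bar>M x - (\<integral>y. uncovered_mass y \<partial>S)\<bar>) =
        (s < \<bar>uncovered_mass x - (\<integral>y. uncovered_mass y \<partial>S)\<bar>)"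
      using M_ae by eventually_elim (simp only:)
  qed measurable
  have tail_G: "measure P {x \<in> space P. \<bar>G x - (\<integral>y. G y \<partial>P)\<bar>
      > 12 * sqrt ((1 + (\<integral>y. h y \<partial>P)) * t / real n) + 23 * t / sqrt (real n)} \<le> 15 * exp (- t)" if "t > 0" for t
    using isolated_tails[OF ne E_h that] unfolding dev_G card .
  have tail_M: "measure P {x \<in> space P. \<bar>M x - (\<integral>y. M y \<partial>P)\<bar>
      > 12 * sqrt ((\<integral>y. h y \<partial>P) * t / real n) + 37 * t / sqrt (real n - 1)} \<le> 2 * real n * exp (- t)" if "t > 0" for t
    using uncovered_tails[OF card_ge E_h that] unfolding dev_M card .

  show ?thesis
    using var_G var_M tail_G tail_M by blast
qed

end
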